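(* Let $\mathcal{P}$ be a separated block and hole polyhedron with swapped block and hole polyhedron $\overline{\mathcal{P}}$, and let $\boldsymbol{p}$ be a configuration of its vertices in projective $3$-space in block and hole general position. Then there is an isomorphism between the space of motion assignments of the swapped block and hole structure $G^{M}(\overline{\mathcal{P}},\boldsymbol{p})$ as a hinged panel polyhedron and the space of stresses of the bar and joint framework $G_S(\mathcal{P},\boldsymbol{p})$ at the same configuration; that is, $\mathcal{S}(G_S(\mathcal{P},\boldsymbol{p}))\simeq \mathcal{M}(G^{M}(\overline{\mathcal{P}},\boldsymbol{p}))$.
   Context: Extensors and frameworks. Points of projective $3$-space $\mathbb{PS}^3$ are represented by fixed homogeneous coordinate vectors in $\mathbb{R}^4$ (finite points as $(a_1,a_2,a_3,1)$). For points $\boldsymbol{a},\boldsymbol{b}$ the $2$-extensor $\boldsymbol{a}\boldsymbol{b}=\boldsymbol{a}\vee\boldsymbol{b}\in\mathbb{R}^6$ is the vector of Plücker coordinates (the six $2\times2$ minors of the $2\times 4$ matrix with rows $\boldsymbol{a},\boldsymbol{b}$), so $\boldsymbol{b}\boldsymbol{a}=-\boldsymbol{a}\boldsymbol{b}$. A bar and joint framework $(G,\boldsymbol{p})$ is a finite graph $G=(V,E)$ with a map (configuration) $\boldsymbol{p}:V\to\mathbb{PS}^3$, $\boldsymbol{p}_i=\boldsymbol{p}(i)$, with $\boldsymbol{p}_i\ne\boldsymbol{p}_j$ for $\{i,j\}\in E$. An equilibrium load assigns to each joint $i$ a vector $\boldsymbol{L}_i=\boldsymbol{f}_i\vee\boldsymbol{p}_i$,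 with $\boldsymbol{f}_i$ having last coordinate $0$, such that $\sum_i\boldsymbol{L}_i=\boldsymbol{0}$. It is resolved by scalars $\lambda_{ij}=\lambda_{ji}$ on the bars if $\boldsymbol{L}_i+\sum_{j:\{i,j\}\in E}\lambda_{ij}\boldsymbol{p}_i\boldsymbol{p}_j=\boldsymbol{0}$ for every $i$. A self-stress is an assignment $\lambda_{ij}=\lambda_{ji}$ resolving the zero load; the vector space of self-stresses is the space of stresses $\mathcal{S}(G,\boldsymbol{p})$. The framework is statically rigid if every equilibrium load is resolved, independent if only the zero self-stress exists, and isostatic if statically rigid and independent. Block and hole polyhedra. An abstract spherical polyhedron is a $3$-connected planar graph drawn on the sphere without crossings, together with the regions of the drawing as faces. A block and hole polyhedron $\mathcal{P}$ is an abstract spherical polyhedron whose faces are partitioned into three disjoint sets: blocks $\mathcal{B}_{\mathcal{P}}$, holes $\mathcal{H}_{\mathcal{P}}$, and the remaining faces, which are triangulated on their vertices, the resulting triangles forming the set $\mathcal{T}_{\mathcal{P}}$ of surface faces. The swapped polyhedron $\overline{\mathcal{P}}$ has $\mathcal{B}_{\overline{\mathcal{P}}}=\mathcal{H}_{\mathcal{P}}$, $\mathcal{H}_{\overline{\mathcal{P}}}=\mathcal{B}_{\mathcal{P}}$, $\mathcal{T}_{\overline{\mathcal{P}}}=\mathcal{T}_{\mathcal{P}}$. Separated means that there is at most one block and at most one hole at any given vertex. Block and hole general position of $\boldsymbol{p}$: adjacent vertices of $\mathcal{P}$ have distinct positions, and no block face and no hole face has all its vertices collinear. The framework $G_S(\mathcal{P},\boldsymbol{p})$: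 the vertices and edges of $\mathcal{P}$, where in addition, for each block, edges (and possibly new vertices in generic position, used only in that block) are inserted so that together with the boundary polygon of the block face they form an isostatic bar and joint framework containing the vertices of that face. The choice of these isostatic subframeworks is arbitrary. The structure $G^M(\mathcal{P},\boldsymbol{p})$: the body and hinge structure whose bodies are the surface triangles and the blocks (not the holes) and whose hinges are the edges of $\mathcal{P}$ separating two such faces. If the edge $\{i,j\}$ separates faces $F^k$ and $F^m$, and $(F^k,F^m)$ is the order in which the faces are crossed after turning the oriented edge from $i$ to $j$ by $90^\circ$ counterclockwise, then $\boldsymbol{D}^{km}=\boldsymbol{p}_i\boldsymbol{p}_j$ and $\boldsymbol{D}^{mk}=\boldsymbol{p}_j\boldsymbol{p}_i=-\boldsymbol{D}^{km}$. A motion assignment is an assignment of scalars $\omega^{km}=\omega^{mk}$ to the hinges such that $\sum\omega^{km}\boldsymbol{D}^{km}=\boldsymbol{0}$ over every closed cycle of bodies and hinges. The vector space of motion assignments is $\mathcal{M}(G^M(\mathcal{P},\boldsymbol{p}))$.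
   Formalization: In the definition of static rigidity of the block subframeworks, loads at joints at infinity may be arbitrary extensors f∨p through the joint, instead of only those with last coordinate of f equal to 0; with the restricted loads the claim fails for some configurations with points at infinity. *)

theory Defs
  imports "HOL-Analysis.Analysis" "HOL-Combinatorics.Orbits"
begin

text \<open>A point is given by a fixed homogeneous coordinate vector, normalised to last coordinate 1
  for finite points.  Points at infinity have last coordinate 0; these carry no normalisation, so
  equality of points is proportionality of the representing vectors.\<close>

definition point_rep :: "real^4 \<Rightarrow> bool" where
  "point_rep x \<longleftrightarrow> x \<noteq> 0 \<and> (x $ 4 = 0 \<or> x $ 4 = 1)"

definition same_point :: "real^4 \<Rightarrow> real^4 \<Rightarrow> bool" where
  "same_point x y \<longleftrightarrow> (\<exists>c. c \<noteq> 0 \<and> y = c *\<^sub>R x)"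

definition collinear_points :: "(real^4) set \<Rightarrow> bool" where
  "collinear_points S \<longleftrightarrow> (\<exists>a b. S \<subseteq> span {a, b})"

definition extensor :: "real^4 \<Rightarrow> real^4 \<Rightarrow> real^6"  (infixl "\<squnion>\<^sub>e" 70) where
  "a \<squnion>\<^sub>e b = vector
     [a$1 * b$2 - a$2 * b$1, a$1 * b$3 - a$3 * b$1, a$1 * b$4 - a$4 * b$1,
      a$2 * b$3 - a$3 * b$2, a$2 * b$4 - a$4 * b$2, a$3 * b$4 - a$4 * b$3]"

lemma forall_6: "(\<forall>i::6. P i) \<longleftrightarrow> P 1 \<and> P 2 \<and> P 3 \<and> P 4 \<and> P 5 \<and> P 6"
proof -
  have "(i::6) = 1 \<or> i = 2 \<or> i = 3 \<or> i = 4 \<or> i = 5 \<or> i = 6" for i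
  proof (induct i)
    case (of_int z)
    then have "z = 0 \<or> z = 1 \<or> z = 2 \<or> z = 3 \<or> z = 4 \<or> z = 5" by fastforce
    then show ?case by auto
  qed
  then show ?thesis by metis
qed

lemma vector_6:
  "(vector [a, b, c, d, e, f] :: ('a::zero)^6) $ 1 = a"
  "(vector [a, b, c, d, e, f] :: ('a::zero)^6) $ 2 = b"
  "(vector [a, b, c, d, e, f] :: ('a::zero)^6) $ 3 = c"
  "(vector [a, b, c, d, e, f] :: ('a::zero)^6) $ 4 = d"
  "(vector [a, b, c, d, e, f] :: ('a::zero)^6) $ 5 = e"
  "(vector [a, b, c, d, e, f] :: ('a::zero)^6) $ 6 = f"
  unfolding vector_def by auto

lemma extensor_anticomm: "b \<squnion>\<^sub>e a = - (a \<squnion>\<^sub>e b)"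
  by (simp add: vec_eq_iff forall_6 extensor_def vector_6)

lemma extensor_diff_self: "(f - c *\<^sub>R x) \<squnion>\<^sub>e x = f \<squnion>\<^sub>e x"
  by (simp add: vec_eq_iff forall_6 extensor_def vector_6 algebra_simps)

record 'v ugraph =
  verts :: "'v set"
  edges :: "'v set set"

definition simple_graph :: "('v, 'z) ugraph_scheme \<Rightarrow> bool" where
  "simple_graph G \<longleftrightarrow>
     finite (verts G) \<and> (\<forall>e \<in> edges G. e \<subseteq> verts G \<and> card e = 2)"

definition nbrs :: "('v, 'z) ugraph_scheme \<Rightarrow> 'v \<Rightarrow> 'v set" where
  "nbrs G v = {u. {v, u} \<in> edges G}"

definition connected_within :: "('v, 'z) ugraph_scheme \<Rightarrow> 'v set \<Rightarrow> bool" where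
  "connected_within G W \<longleftrightarrow>
     (\<forall>u \<in> W. \<forall>v \<in> W. (u, v) \<in> {(x, y). x \<in> W \<and> y \<in> W \<and> {x, y} \<in> edges G}\<^sup>*)"

definition three_connected :: "('v, 'z) ugraph_scheme \<Rightarrow> bool" where
  "three_connected G \<longleftrightarrow>
     card (verts G) \<ge> 4 \<and>
     (\<forall>X \<subseteq> verts G. card X \<le> 2 \<longrightarrow> connected_within G (verts G - X))"

definition framework :: "('v, 'z) ugraph_scheme \<Rightarrow> ('v \<Rightarrow> real^4) \<Rightarrow> bool" where
  "framework G p \<longleftrightarrow>
     simple_graph G \<and> (\<forall>v \<in> verts G. point_rep (p v)) \<and>
     (\<forall>i j. {i, j} \<in> edges G \<longrightarrow> \<not> same_point (p i) (p j))"

text \<open>A load at a joint is an extensor through that joint.  At a finite joint the vector \<open>f\<close>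
  may be taken with last coordinate 0, see \<open>load_at_finite_joint\<close> below.  At a joint at infinity
  that restriction would leave only the lines in the plane at infinity and would not be invariant
  under projective transformations, so it is not imposed there.\<close>

definition load_at :: "real^4 \<Rightarrow> real^6 \<Rightarrow> bool" where
  "load_at x L \<longleftrightarrow> (\<exists>f. L = f \<squnion>\<^sub>e x)"

lemma load_at_finite_joint:
  assumes "x $ 4 \<noteq> 0"
  shows "load_at x L \<longleftrightarrow> (\<exists>f. f $ 4 = 0 \<and> L = f \<squnion>\<^sub>e x)"
proof
  assume "load_at x L"
  then obtain f where f: "L = f \<squnion>\<^sub>e x" by (auto simp: load_at_def)
  let ?g = "f - (f $ 4 / x $ 4) *\<^sub>R x"
  have "?g $ 4 = 0" using assms by simp
  moreover have "L = ?g \<squnion>\<^sub>e x" by (simp only: f extensor_diff_self)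
  ultimately show "\<exists>f. f $ 4 = 0 \<and> L = f \<squnion>\<^sub>e x" by blast
qed (auto simp: load_at_def)

definition equilibrium_load ::
    "('v, 'z) ugraph_scheme \<Rightarrow> ('v \<Rightarrow> real^4) \<Rightarrow> ('v \<Rightarrow> real^6) \<Rightarrow> bool" where
  "equilibrium_load G p L \<longleftrightarrow>
     (\<forall>i \<in> verts G. load_at (p i) (L i)) \<and> (\<Sum>i \<in> verts G. L i) = 0"

text \<open>Scalars on bars are functions of the unordered edge, whence \<open>\<lambda>\<^sub>i\<^sub>j = \<lambda>\<^sub>j\<^sub>i\<close>.\<close>

definition resolves ::
    "('v, 'z) ugraph_scheme \<Rightarrow> ('v \<Rightarrow> real^4) \<Rightarrow> ('v \<Rightarrow> real^6) \<Rightarrow> ('v set \<Rightarrow> real) \<Rightarrow> bool" where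
  "resolves G p L l \<longleftrightarrow>
     (\<forall>i \<in> verts G. L i + (\<Sum>j \<in> nbrs G i. l {i, j} *\<^sub>R (p i \<squnion>\<^sub>e p j)) = 0)"

text \<open>Functions on the edge set are represented by functions vanishing off it.\<close>

definition stresses :: "('v, 'z) ugraph_scheme \<Rightarrow> ('v \<Rightarrow> real^4) \<Rightarrow> ('v set \<Rightarrow> real) set" where
  "stresses G p = {l. (\<forall>e. e \<notin> edges G \<longrightarrow> l e = 0) \<and> resolves G p (\<lambda>_. 0) l}"

definition statically_rigid :: "('v, 'z) ugraph_scheme \<Rightarrow> ('v \<Rightarrow> real^4) \<Rightarrow> bool" where
  "statically_rigid G p \<longleftrightarrow> (\<forall>L. equilibrium_load G p L \<longrightarrow> (\<exists>l. resolves G p L l))"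

definition independent_framework :: "('v, 'z) ugraph_scheme \<Rightarrow> ('v \<Rightarrow> real^4) \<Rightarrow> bool" where
  "independent_framework G p \<longleftrightarrow> stresses G p = {\<lambda>_. 0}"

definition isostatic :: "('v, 'z) ugraph_scheme \<Rightarrow> ('v \<Rightarrow> real^4) \<Rightarrow> bool" where
  "isostatic G p \<longleftrightarrow> statically_rigid G p \<and> independent_framework G p"

text \<open>A crossing-free drawing of a connected graph on the oriented sphere is given, up to
  homeomorphism, by its rotation system: \<open>cw v u\<close> is the neighbour of \<open>v\<close> that follows \<open>u\<close> in
  clockwise order around \<open>v\<close>.  The face to the left of the oriented edge \<open>(u, v)\<close> is traced
  by proceeding to \<open>(v, cw v u)\<close>; a face is identified with the set of oriented edges that have
  it on their left.  Among rotation systems, those on the sphere are singled out by Euler's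
  formula.\<close>

record 'v drawing = "'v ugraph" +
  cw :: "'v \<Rightarrow> 'v \<Rightarrow> 'v"

definition darts :: "('v, 'z) ugraph_scheme \<Rightarrow> ('v \<times> 'v) set" where
  "darts G = {(u, v). {u, v} \<in> edges G}"

definition rotation_system :: "('v, 'z) drawing_scheme \<Rightarrow> bool" where
  "rotation_system P \<longleftrightarrow>
     (\<forall>v \<in> verts P. bij_betw (cw P v) (nbrs P v) (nbrs P v) \<and>
        (\<forall>u \<in> nbrs P v. \<forall>w \<in> nbrs P v. \<exists>n. w = (cw P v ^^ n) u))"

definition face_next :: "('v, 'z) drawing_scheme \<Rightarrow> 'v \<times> 'v \<Rightarrow> 'v \<times> 'v" where
  "face_next P d = (snd d, cw P (snd d) (fst d))"

definition left_face :: "('v, 'z) drawing_scheme \<Rightarrow> 'v \<times> 'v \<Rightarrow> ('v \<times> 'v) set" where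
  "left_face P d = orbit (face_next P) d"

definition right_face :: "('v, 'z) drawing_scheme \<Rightarrow> 'v \<times> 'v \<Rightarrow> ('v \<times> 'v) set" where
  "right_face P d = left_face P (prod.swap d)"

definition faces :: "('v, 'z) drawing_scheme \<Rightarrow> ('v \<times> 'v) set set" where
  "faces P = left_face P ` darts P"

definition face_verts :: "('v \<times> 'v) set \<Rightarrow> 'v set" where
  "face_verts F = fst ` F"

definition face_edges :: "('v \<times> 'v) set \<Rightarrow> 'v set set" where
  "face_edges F = (\<lambda>(u, v). {u, v}) ` F"

definition spherical_polyhedron :: "('v, 'z) drawing_scheme \<Rightarrow> bool" where
  "spherical_polyhedron P \<longleftrightarrow>
     simple_graph P \<and> three_connected P \<and> rotation_system P \<and>
     int (card (verts P)) - int (card (edges P)) + int (card (faces P)) = 2"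

text \<open>The underlying drawing is the one in which the faces that are neither blocks nor holes have
  already been triangulated.\<close>

record 'v bh_poly = "'v drawing" +
  blocks :: "('v \<times> 'v) set set"
  holes :: "('v \<times> 'v) set set"

definition surface_faces :: "'v bh_poly \<Rightarrow> ('v \<times> 'v) set set" where
  "surface_faces P = faces P - blocks P - holes P"

definition block_hole_polyhedron :: "'v bh_poly \<Rightarrow> bool" where
  "block_hole_polyhedron P \<longleftrightarrow>
     spherical_polyhedron P \<and>
     blocks P \<subseteq> faces P \<and> holes P \<subseteq> faces P \<and> blocks P \<inter> holes P = {} \<and>
     (\<forall>F \<in> surface_faces P. card F = 3)"

definition swapped :: "'v bh_poly \<Rightarrow> 'v bh_poly" where
  "swapped P = P\<lparr>blocks := holes P, holes := blocks P\<rparr>"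

definition separated :: "'v bh_poly \<Rightarrow> bool" where
  "separated P \<longleftrightarrow>
     (\<forall>v \<in> verts P.
        (\<forall>B \<in> blocks P. \<forall>C \<in> blocks P. v \<in> face_verts B \<and> v \<in> face_verts C \<longrightarrow> B = C) \<and>
        (\<forall>H \<in> holes P. \<forall>K \<in> holes P. v \<in> face_verts H \<and> v \<in> face_verts K \<longrightarrow> H = K))"

definition bh_general_position :: "'v bh_poly \<Rightarrow> ('v \<Rightarrow> real^4) \<Rightarrow> bool" where
  "bh_general_position P p \<longleftrightarrow>
     (\<forall>i j. {i, j} \<in> edges P \<longrightarrow> \<not> same_point (p i) (p j)) \<and>
     (\<forall>F \<in> blocks P \<union> holes P. \<not> collinear_points (p ` face_verts F))"

text \<open>A choice of isostatic subframeworks: \<open>K B\<close> is the graph filling the block \<open>B\<close>, and \<open>q\<close>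
  extends \<open>p\<close> to the new vertices.  The inserted edges, that is, the edges of \<open>K B\<close> off the
  boundary polygon, are not edges of \<open>P\<close>.  New vertices may sit anywhere subject to \<open>K B\<close>
  being isostatic.\<close>

definition block_filling ::
    "'v bh_poly \<Rightarrow> ('v \<Rightarrow> real^4) \<Rightarrow> (('v \<times> 'v) set \<Rightarrow> 'v ugraph) \<Rightarrow> ('v \<Rightarrow> real^4) \<Rightarrow> bool" where
  "block_filling P p K q \<longleftrightarrow>
     (\<forall>v \<in> verts P. q v = p v) \<and>
     (\<forall>B \<in> blocks P.
        framework (K B) q \<and> isostatic (K B) q \<and>
        verts (K B) \<inter> verts P = face_verts B \<and>
        edges (K B) \<inter> edges P = face_edges B \<and>
        (\<forall>C \<in> blocks P. C \<noteq> B \<longrightarrow> verts (K B) \<inter> verts (K C) \<subseteq> verts P))"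

definition G_S :: "'v bh_poly \<Rightarrow> (('v \<times> 'v) set \<Rightarrow> 'v ugraph) \<Rightarrow> 'v ugraph" where
  "G_S P K = \<lparr>verts = verts P \<union> (\<Union>B \<in> blocks P. verts (K B)),
              edges = edges P \<union> (\<Union>B \<in> blocks P. edges (K B))\<rparr>"

definition bodies :: "'v bh_poly \<Rightarrow> ('v \<times> 'v) set set" where
  "bodies P = surface_faces P \<union> blocks P"

definition hinges :: "'v bh_poly \<Rightarrow> 'v set set" where
  "hinges P = {{i, j} | i j. (i, j) \<in> darts P \<and>
     left_face P (i, j) \<in> bodies P \<and> right_face P (i, j) \<in> bodies P \<and>
     left_face P (i, j) \<noteq> right_face P (i, j)}"

text \<open>Turning \<open>(i, j)\<close> counterclockwise by a right angle, one crosses from its right face \<open>F\<^sup>k\<close> to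
  its left face \<open>F\<^sup>m\<close>; such a crossing is recorded by the oriented edge \<open>(i, j)\<close> and carries
  the extensor \<open>D\<^sup>k\<^sup>m = p i \<squnion>\<^sub>e p j\<close>.  A closed cycle of bodies and hinges is the cyclic list of
  its crossings; bodies may repeat, which imposes nothing beyond the cycles without repetition because
  every closed cycle splits into such ones and immediate returns.\<close>

definition closed_body_cycle :: "'v bh_poly \<Rightarrow> ('v \<times> 'v) list \<Rightarrow> bool" where
  "closed_body_cycle P ds \<longleftrightarrow>
     (\<forall>(i, j) \<in> set ds. {i, j} \<in> hinges P) \<and>
     map (left_face P) ds = map (right_face P) (rotate1 ds)"

definition motion_assignments :: "'v bh_poly \<Rightarrow> ('v \<Rightarrow> real^4) \<Rightarrow> ('v set \<Rightarrow> real) set" where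
  "motion_assignments P p =
     {w. (\<forall>e. e \<notin> hinges P \<longrightarrow> w e = 0) \<and>
         (\<forall>ds. closed_body_cycle P ds \<longrightarrow>
            (\<Sum>(i, j) \<leftarrow> ds. w {i, j} *\<^sub>R (p i \<squnion>\<^sub>e p j)) = 0)}"

definition fun_subspace :: "('a \<Rightarrow> real) set \<Rightarrow> bool" where
  "fun_subspace S \<longleftrightarrow>
     (\<lambda>_. 0) \<in> S \<and> (\<forall>x \<in> S. \<forall>y \<in> S. (\<lambda>e. x e + y e) \<in> S) \<and> (\<forall>c. \<forall>x \<in> S. (\<lambda>e. c * x e) \<in> S)"

definition linearly_isomorphic ::
    "('a \<Rightarrow> real) set \<Rightarrow> ('b \<Rightarrow> real) set \<Rightarrow> bool"  (infix "\<simeq>\<^sub>l" 50) where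
  "S \<simeq>\<^sub>l M \<longleftrightarrow>
     (\<exists>\<Phi>. bij_betw \<Phi> S M \<and>
        (\<forall>x \<in> S. \<forall>y \<in> S. \<Phi> (\<lambda>e. x e + y e) = (\<lambda>e. \<Phi> x e + \<Phi> y e)) \<and>
        (\<forall>c. \<forall>x \<in> S. \<Phi> (\<lambda>e. c * x e) = (\<lambda>e. c * \<Phi> x e)))"

lemma fun_subspace_stresses: "fun_subspace (stresses G p)"
  by (auto simp: fun_subspace_def stresses_def resolves_def scaleR_add_left sum.distrib
      simp flip: scaleR_scaleR scaleR_sum_right)

lemma fun_subspace_motion_assignments: "fun_subspace (motion_assignments P p)"
proof -
  have add: "(\<Sum>(i, j) \<leftarrow> ds. (x {i, j} + y {i, j}) *\<^sub>R (p i \<squnion>\<^sub>e p j)) =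
      (\<Sum>(i, j) \<leftarrow> ds. x {i, j} *\<^sub>R (p i \<squnion>\<^sub>e p j)) +
      (\<Sum>(i, j) \<leftarrow> ds. y {i, j} *\<^sub>R (p i \<squnion>\<^sub>e p j))" for x y :: "'a set \<Rightarrow> real" and ds
    by (induction ds) (auto simp: scaleR_add_left)
  have scale: "(\<Sum>(i, j) \<leftarrow> ds. (c * x {i, j}) *\<^sub>R (p i \<squnion>\<^sub>e p j)) =
      c *\<^sub>R (\<Sum>(i, j) \<leftarrow> ds. x {i, j} *\<^sub>R (p i \<squnion>\<^sub>e p j))" for c and x :: "'a set \<Rightarrow> real" and ds
    by (induction ds) (auto simp: scaleR_add_right)
  have zero: "(\<Sum>(i, j) \<leftarrow> ds. (0::real) *\<^sub>R (p i \<squnion>\<^sub>e p j)) = 0" for ds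
    by (induction ds) auto
  show ?thesis
    using zero by (auto simp: fun_subspace_def motion_assignments_def add scale)
qed

end

theory Submission
  imports Defs
begin

text \<open>Restricting a stress to the edges of the polyhedron that border no block is the required
  isomorphism.  These free edges are exactly the hinges of the swapped structure, whose bodies
  are all faces but the blocks.  The same extensors \<open>p i \<squnion>\<^sub>e p j\<close> appear as bar forces on one side
  and as relative motions on the other, and the two sides impose the same conditions.

  On the static side, a joint off the blocks is balanced by free edges only.  In a block the
  free edges exert a load on the vertices, and the block, being isostatic, resolves this load if
  and only if its total is zero, and then in exactly one way.  Here separation enters: a vertex
  belongs to at most one block, so the loads on different blocks can be resolved independently.
  Hence stresses correspond to scalars on the free edges with zero sum of forces at each joint off
  the blocks and over each block (\<open>stresses_iff\<close>).

  On the kinematic side, going around a vertex off the blocks, or around a block, is a closed cycle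
  of bodies, and these cycles yield the same equations.  That they suffice
  (\<open>motion_assignments_swapped_iff\<close>) is where the sphere enters.  A flow along the boundary of
  each block completes the forces to a function on all darts with zero outflow at every vertex.  On
  the sphere such a circulation is a difference of potentials of faces
  (\<open>circulation_is_face_difference\<close>), so its sums over closed cycles vanish.  The latter fact is
  derived from Euler's formula by means of a spanning tree of the dual graph and the complementary
  spanning tree of the graph.

  It also gives, with 3-connectedness, that every edge separates two distinct faces
  (\<open>left_face_ne_right_face\<close>): an edge with the same face on both sides would be traversed by
  no circulation, although it lies on a cycle.  So every free edge is a hinge.\<close>

section \<open>Circulations and spanning trees on sets of darts\<close>

text \<open>A finite symmetric set of darts carries several multigraphs at once, one for each tail map:
  with \<open>fst\<close> its vertices are those of the drawing, with \<open>left_face P\<close> they are the faces, so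
  that graph and dual graph share their darts and every lemma of this section serves both.\<close>

locale symmetric_darts =
  fixes D :: "('v \<times> 'v) set"
  assumes finite_D: "finite D"
    and swap_D: "d \<in> D \<Longrightarrow> prod.swap d \<in> D"
begin

text \<open>The discrete divergence; a circulation is a 1-cycle of the multigraph with tail map \<open>t\<close>.\<close>

definition outflow :: "('v \<times> 'v \<Rightarrow> 'x) \<Rightarrow> ('v \<times> 'v \<Rightarrow> 'b::real_vector) \<Rightarrow> 'x \<Rightarrow> 'b" where
  "outflow t c x = (\<Sum>d | d \<in> D \<and> t d = x. c d)"

definition antisymmetric :: "('v \<times> 'v \<Rightarrow> 'b::real_vector) \<Rightarrow> bool" where
  "antisymmetric c \<longleftrightarrow> (\<forall>d \<in> D. c (prod.swap d) = - c d)"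

definition circulation :: "('v \<times> 'v \<Rightarrow> 'x) \<Rightarrow> ('v \<times> 'v \<Rightarrow> 'b::real_vector) \<Rightarrow> bool" where
  "circulation t c \<longleftrightarrow> antisymmetric c \<and> (\<forall>d \<in> D. outflow t c (t d) = 0)"

lemma bij_betw_swap: "bij_betw prod.swap D D"
  by (rule bij_betwI[where g = prod.swap]) (auto simp: swap_D)

lemma sum_swap: "(\<Sum>d\<in>D. g (prod.swap d)) = (\<Sum>d\<in>D. g d)"
  by (rule sum.reindex_bij_betw[OF bij_betw_swap])

lemma sum_outflow: "(\<Sum>x \<in> t ` D. outflow t c x) = (\<Sum>d\<in>D. c d)"
  unfolding outflow_def by (rule sum.group) (auto simp: finite_D)

lemma sum_antisymmetric:
  assumes "antisymmetric c"
  shows "(\<Sum>d\<in>D. c d) = 0"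
proof -
  have "(\<Sum>d\<in>D. c d) = - (\<Sum>d\<in>D. c d)"
    using sum_swap[of c] assms by (simp add: antisymmetric_def sum_negf)
  then have "2 *\<^sub>R (\<Sum>d\<in>D. c d) = 0"
    by (simp add: scaleR_2 eq_neg_iff_add_eq_0)
  then show ?thesis
    by simp
qed

text \<open>Summation by parts: collecting the terms at each vertex leaves the net outflow times the
  potential.\<close>

lemma circulation_orthogonal:
  fixes c :: "'v \<times> 'v \<Rightarrow> 'b::real_inner"
  assumes "circulation t c"
  shows "(\<Sum>d\<in>D. c d \<bullet> (S (t d) - S (t (prod.swap d)))) = 0"
proof -
  have "(\<Sum>d\<in>D. c d \<bullet> S (t d)) = (\<Sum>x \<in> t ` D. \<Sum>d | d \<in> D \<and> t d = x. c d \<bullet> S (t d))"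
    by (rule sum.group[symmetric]) (auto simp: finite_D)
  also have "\<dots> = (\<Sum>x \<in> t ` D. outflow t c x \<bullet> S x)"
    by (simp add: outflow_def inner_sum_left)
  also have "\<dots> = 0"
    using assms by (auto simp: circulation_def intro!: sum.neutral)
  finally have tail: "(\<Sum>d\<in>D. c d \<bullet> S (t d)) = 0" .
  have "(\<Sum>d\<in>D. c d \<bullet> S (t (prod.swap d))) = (\<Sum>d\<in>D. c (prod.swap d) \<bullet> S (t d))"
    using sum_swap[of "\<lambda>d. c (prod.swap d) \<bullet> S (t d)"] by simp
  also have "\<dots> = - (\<Sum>d\<in>D. c d \<bullet> S (t d))"
    using assms by (simp add: circulation_def antisymmetric_def sum_negf)
  finally show ?thesis
    using tail by (simp add: inner_diff_right sum_subtractf)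
qed

text \<open>Both darts of each edge are recorded, so that the darts off a tree are again symmetric and
  can be searched for a second tree.\<close>

inductive tree :: "('v \<times> 'v \<Rightarrow> 'x) \<Rightarrow> 'x \<Rightarrow> 'x set \<Rightarrow> ('v \<times> 'v) set \<Rightarrow> bool" for t r where
  root: "tree t r {r} {}"
| leaf: "tree t r W T \<Longrightarrow> d \<in> D \<Longrightarrow> t d \<in> W \<Longrightarrow> t (prod.swap d) \<notin> W \<Longrightarrow>
    tree t r (insert (t (prod.swap d)) W) (insert d (insert (prod.swap d) T))"

lemma tree_darts:
  assumes "tree t r W T"
  shows "T \<subseteq> D" and "r \<in> W" and "d \<in> T \<Longrightarrow> t d \<in> W" and "d \<in> T \<Longrightarrow> prod.swap d \<in> T"
  using assms by (induction arbitrary: d rule: tree.induct) (auto simp: swap_D)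

lemma tree_card:
  assumes "tree t r W T"
  shows "finite W \<and> finite T \<and> card T + 2 = 2 * card W"
  using assms
proof (induction rule: tree.induct)
  case (leaf W T d)
  have "prod.swap d \<notin> T" "d \<notin> T"
    using tree_darts(3)[OF leaf(1)] tree_darts(4)[OF leaf(1), of d] leaf(4) by blast+
  moreover have "d \<noteq> prod.swap d"
    using leaf(3,4) by metis
  ultimately show ?case
    using leaf by simp
qed simp

lemma tree_within:
  assumes "tree t r W T" "\<And>d. d \<in> D \<Longrightarrow> t d \<in> V" "r \<in> V"
  shows "W \<subseteq> V"
  using assms by (induction rule: tree.induct) (auto simp: swap_D)

text \<open>Connectedness is the hypothesis that no proper set of vertices containing the root is closed
  under darts; a tree of maximal size spans such a closed set.\<close>

lemma spanning_tree:
  assumes "finite V" "r \<in> V" "\<And>d. d \<in> D \<Longrightarrow> t d \<in> V"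
    and connected: "\<And>W. r \<in> W \<Longrightarrow> W \<subseteq> V \<Longrightarrow>
      (\<And>d. d \<in> D \<Longrightarrow> t d \<in> W \<Longrightarrow> t (prod.swap d) \<in> W) \<Longrightarrow> W = V"
  shows "\<exists>T. tree t r V T"
proof -
  let ?Q = "\<lambda>n. \<exists>W T. tree t r W T \<and> card W = n"
  have within: "W \<subseteq> V" if "tree t r W T" for W T
    using tree_within[of t r W T V] that assms(2,3) by simp
  have bound: "\<forall>n. ?Q n \<longrightarrow> n \<le> card V"
  proof (intro allI impI)
    fix n
    assume "?Q n"
    then obtain W T where "tree t r W T" "card W = n"
      by blast
    then show "n \<le> card V"
      using within card_mono[OF assms(1)] by blast
  qed
  have "?Q (card {r})"
    by (intro exI conjI, rule tree.root, rule refl)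
  then have "?Q (Greatest ?Q)"
    by (rule GreatestI_nat) (use bound in blast)
  then obtain W T where WT: "tree t r W T" "card W = Greatest ?Q"
    by blast
  have "t (prod.swap d) \<in> W" if d: "d \<in> D" "t d \<in> W" for d
  proof (rule ccontr)
    assume new: "t (prod.swap d) \<notin> W"
    have "?Q (card (insert (t (prod.swap d)) W))"
      using leaf[OF WT(1) d new] by blast
    then have "card (insert (t (prod.swap d)) W) \<le> Greatest ?Q"
      by (rule Greatest_le_nat) (use bound in blast)
    then show False
      using new tree_card[OF WT(1)] WT(2) by simp
  qed
  then have "W = V"
    using connected[of W] tree_darts(2)[OF WT(1)] within[OF WT(1)] by blast
  then show ?thesis
    using WT(1) by blast
qed

text \<open>On a tree every antisymmetric function is a potential difference, because the value of the
  potential at each new leaf can be chosen.\<close>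

lemma tree_potential:
  assumes "tree t r W T" "antisymmetric c"
  shows "\<exists>S. \<forall>d\<in>T. c d = S (t d) - S (t (prod.swap d))"
  using assms
proof (induction rule: tree.induct)
  case (leaf W T d)
  then obtain S where S: "\<forall>e\<in>T. c e = S (t e) - S (t (prod.swap e))"
    by blast
  let ?S = "S(t (prod.swap d) := S (t d) - c d)"
  have "t e \<noteq> t (prod.swap d)" "t (prod.swap e) \<noteq> t (prod.swap d)" if "e \<in> T" for e
    using tree_darts(3,4)[OF leaf(1)] that leaf(4) by metis+
  moreover have "t d \<noteq> t (prod.swap d)"
    using leaf(3,4) by metis
  moreover have "c (prod.swap d) = - c d"
    using leaf by (simp add: antisymmetric_def)
  ultimately have "\<forall>e\<in>insert d (insert (prod.swap d) T). c e = ?S (t e) - ?S (t (prod.swap e))"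
    using S by auto
  then show ?case
    by (rule exI[where x = "?S"])
qed auto

text \<open>On a tree a circulation agrees with some potential difference, hence is orthogonal to
  itself.\<close>

lemma circulation_on_tree:
  fixes c :: "'v \<times> 'v \<Rightarrow> 'b::real_inner"
  assumes "tree t r W T" "circulation t c" "\<And>d. d \<in> D \<Longrightarrow> d \<notin> T \<Longrightarrow> c d = 0" "d \<in> D"
  shows "c d = 0"
proof -
  obtain S where S: "\<forall>d\<in>T. c d = S (t d) - S (t (prod.swap d))"
    using tree_potential[OF assms(1), of c] assms(2) unfolding circulation_def by blast
  have "(\<Sum>d\<in>D. c d \<bullet> c d) = (\<Sum>d\<in>D. c d \<bullet> (S (t d) - S (t (prod.swap d))))"
    using S assms(3) by (intro sum.cong refl) (metis inner_zero_left)
  also have "\<dots> = 0"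
    by (rule circulation_orthogonal[OF assms(2)])
  finally have "\<forall>d\<in>D. c d \<bullet> c d = 0"
    by (subst (asm) sum_nonneg_eq_0_iff) (auto simp: finite_D)
  then show ?thesis
    using assms(4) by simp
qed

definition edge_flow :: "'b::real_vector \<Rightarrow> 'v \<Rightarrow> 'v \<Rightarrow> 'v \<times> 'v \<Rightarrow> 'b" where
  "edge_flow x a b d = (if d = (a, b) then x else 0) - (if d = (b, a) then x else 0)"

lemma outflow_edge_flow:
  assumes "(a, b) \<in> D"
  shows "outflow fst (edge_flow x a b) v = (if v = a then x else 0) - (if v = b then x else 0)"
proof -
  have "(\<Sum>d | d \<in> D \<and> fst d = v. if d = e then x else 0) = (if v = fst e then x else 0)"
    if "e \<in> D" for e
    using that finite_D by (subst sum.delta) auto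
  then show ?thesis
    using assms swap_D[OF assms] by (simp add: outflow_def edge_flow_def sum_subtractf)
qed

lemma antisymmetric_edge_flow: "antisymmetric (edge_flow x a b)"
proof -
  have "prod.swap d = (a, b) \<longleftrightarrow> d = (b, a)" for a b and d :: "'v \<times> 'v"
    by (cases d) auto
  then show ?thesis
    by (simp add: antisymmetric_def edge_flow_def)
qed

text \<open>Any amount can be transported from \<open>a\<close> to \<open>b\<close> through the edges of \<open>R\<close> alone; the
  restriction to \<open>R\<close> is what later confines a flow to the boundary of a block, or keeps it off
  a given edge.\<close>

lemma path_flow:
  assumes "(a, b) \<in> R\<^sup>*" "R \<subseteq> D" "sym R"
  shows "\<exists>f. antisymmetric f \<and> (\<forall>d. d \<notin> R \<longrightarrow> f d = 0) \<and>
    (\<forall>v. outflow fst f v = (if v = a then x else 0) - (if v = b then x else 0))"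
  using assms(1)
proof (induction rule: rtrancl_induct)
  case base
  then show ?case
    by (intro exI[where x = "\<lambda>_. 0"]) (auto simp: antisymmetric_def outflow_def)
next
  case (step y z)
  then obtain f where f: "antisymmetric f" "\<forall>d. d \<notin> R \<longrightarrow> f d = 0"
    "\<forall>v. outflow fst f v = (if v = a then x else 0) - (if v = y then x else 0)"
    by blast
  let ?g = "edge_flow x y z"
  have yz: "(y, z) \<in> R" "(z, y) \<in> R"
    using step(2) assms(3) by (auto dest: symD)
  have "outflow fst (\<lambda>d. f d + ?g d) v = outflow fst f v + outflow fst ?g v" for v
    by (simp add: outflow_def sum.distrib)
  then have "\<forall>v. outflow fst (\<lambda>d. f d + ?g d) v =
      (if v = a then x else 0) - (if v = z then x else 0)"
    using f(3) outflow_edge_flow[of y z x] yz assms(2) by (simp add: subset_iff)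
  moreover have "antisymmetric (\<lambda>d. f d + ?g d)"
    using f(1) antisymmetric_edge_flow[of x y z] by (simp add: antisymmetric_def)
  moreover have "\<forall>d. d \<notin> R \<longrightarrow> f d + ?g d = 0"
  proof (intro allI impI)
    fix d
    assume "d \<notin> R"
    then have "d \<noteq> (y, z)" "d \<noteq> (z, y)"
      using yz by blast+
    moreover have "f d = 0"
      using f(2) \<open>d \<notin> R\<close> by blast
    ultimately show "f d + ?g d = 0"
      by (simp add: edge_flow_def)
  qed
  ultimately show ?case
    by (intro exI[where x = "\<lambda>d. f d + ?g d"]) blast
qed

subsection \<open>Closed walks and potentials\<close>

text \<open>With \<open>t = left_face P\<close> a step of a walk passes from the right face of a dart to its left
  face, the convention for cycles of bodies.\<close>

fun walk :: "('v \<times> 'v \<Rightarrow> 'x) \<Rightarrow> 'x \<Rightarrow> ('v \<times> 'v) list \<Rightarrow> 'x \<Rightarrow> bool" where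
  "walk t a [] b \<longleftrightarrow> a = b"
| "walk t a (d # ds) b \<longleftrightarrow> d \<in> D \<and> t (prod.swap d) = a \<and> walk t (t d) ds b"

lemma walk_append:
  "walk t a ds b \<Longrightarrow> walk t b es c \<Longrightarrow> walk t a (ds @ es) c"
  by (induction ds arbitrary: a) auto

lemma walk_rev:
  "walk t a ds b \<Longrightarrow> walk t b (rev (map prod.swap ds)) a"
proof (induction ds arbitrary: a)
  case (Cons d ds)
  then have "walk t b (rev (map prod.swap ds)) (t d)" "walk t (t d) [prod.swap d] a"
    by (simp_all add: swap_D)
  then show ?case
    using walk_append by fastforce
qed simp

lemma walk_darts: "walk t a ds b \<Longrightarrow> set ds \<subseteq> D"
  by (induction ds arbitrary: a) auto

lemma walk_tails:
  "walk t a ds b \<Longrightarrow> a # map t ds = map (t \<circ> prod.swap) ds @ [b]"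
  by (induction ds arbitrary: a) auto

lemma closed_walk_rotate1:
  assumes "walk t a ds a"
  shows "map t ds = map (t \<circ> prod.swap) (rotate1 ds)"
  using walk_tails[OF assms] assms by (cases ds) auto

lemma sum_list_walk_rev:
  assumes "antisymmetric c" "walk t a ds b"
  shows "(\<Sum>d\<leftarrow>rev (map prod.swap ds). c d) = - (\<Sum>d\<leftarrow>ds. c d)"
  using assms(2)
proof (induction ds arbitrary: a)
  case (Cons d ds)
  then have "d \<in> D" "walk t (t d) ds b"
    by simp_all
  then show ?case
    using assms(1) Cons.IH by (simp add: antisymmetric_def)
qed simp

text \<open>The potential at \<open>b\<close> is the sum of \<open>c\<close> along a chosen walk to \<open>b\<close> from a chosen vertex of
  its component.\<close>

lemma closed_walks_zero_imp_potential:
  assumes "antisymmetric c"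
    and zero: "\<And>a ds. walk t a ds a \<Longrightarrow> (\<Sum>d\<leftarrow>ds. c d) = 0"
  shows "\<exists>S. \<forall>d\<in>D. c d = S (t d) - S (t (prod.swap d))"
proof -
  define root_of where "root_of b = (SOME a. \<exists>ds. walk t a ds b)" for b
  define path where "path b = (SOME ds. walk t (root_of b) ds b)" for b
  define S where "S b = (\<Sum>d\<leftarrow>path b. c d)" for b
  have "\<exists>ds. walk t (root_of b) ds b" for b
    unfolding root_of_def by (rule someI[where x = b]) (rule exI[where x = "[]"], simp)
  then have path: "walk t (root_of b) (path b) b" for b
    unfolding path_def by (rule someI_ex)
  have "c d = S (t d) - S (t (prod.swap d))" if d: "d \<in> D" for d
  proof -
    let ?a = "t (prod.swap d)" and ?b = "t d"
    have fwd: "walk t ?a [d] ?b" and bwd: "walk t ?b [prod.swap d] ?a"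
      using d by (auto simp: swap_D)
    have "(\<exists>ds. walk t r ds ?a) \<longleftrightarrow> (\<exists>ds. walk t r ds ?b)" for r
      using walk_append[OF _ fwd] walk_append[OF _ bwd] by blast
    \<comment> \<open>Both ends have the same candidates, so choice returns the same vertex for them.\<close>
    then have "root_of ?a = root_of ?b"
      by (simp add: root_of_def)
    then have "walk t (root_of ?a) (path ?a @ [d] @ rev (map prod.swap (path ?b))) (root_of ?a)"
      using walk_append[OF path walk_append[OF fwd walk_rev[OF path]]] by simp
    from zero[OF this] show ?thesis
      using sum_list_walk_rev[OF assms(1) path[of ?b]] by (simp add: S_def algebra_simps)
  qed
  then show ?thesis
    by blast
qed

end

section \<open>Forces at the joints of a graph\<close>

text \<open>The same extensor plays two parts: the force of the bar \<open>{i, j}\<close> at its joint \<open>i\<close> in a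
  framework, and the relative motion across the hinge \<open>{i, j}\<close> in a structure of bodies, when it
  is crossed from the right of the dart \<open>(i, j)\<close> to its left.\<close>

definition dart_force :: "('v \<Rightarrow> real^4) \<Rightarrow> ('v set \<Rightarrow> real) \<Rightarrow> 'v \<times> 'v \<Rightarrow> real^6" where
  "dart_force p w = (\<lambda>(i, j). w {i, j} *\<^sub>R (p i \<squnion>\<^sub>e p j))"

definition joint_force ::
    "('v, 'z) ugraph_scheme \<Rightarrow> ('v \<Rightarrow> real^4) \<Rightarrow> ('v set \<Rightarrow> real) \<Rightarrow> 'v \<Rightarrow> real^6" where
  "joint_force G p w v = (\<Sum>u\<in>nbrs G v. dart_force p w (v, u))"

lemma resolves_iff_joint_force:
  "resolves G p L l \<longleftrightarrow> (\<forall>v\<in>verts G. L v + joint_force G p l v = 0)"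
  by (simp add: resolves_def joint_force_def dart_force_def)

lemma joint_force_diff:
  "joint_force G p (\<lambda>e. w e - w' e) v = joint_force G p w v - joint_force G p w' v"
  by (simp add: joint_force_def dart_force_def scaleR_diff_left sum_subtractf)

locale simple_graph_darts =
  fixes G :: "('v, 'z) ugraph_scheme"
  assumes simple: "simple_graph G"
begin

lemma dart_verts: "(u, v) \<in> darts G \<Longrightarrow> u \<in> verts G \<and> v \<in> verts G \<and> u \<noteq> v"
  using simple by (auto simp: darts_def simple_graph_def)

lemma finite_verts: "finite (verts G)"
  using simple by (simp add: simple_graph_def)

lemma finite_darts: "finite (darts G)"
proof (rule finite_subset)
  show "darts G \<subseteq> verts G \<times> verts G"
    using dart_verts by auto
  show "finite (verts G \<times> verts G)"
    by (simp add: finite_verts)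
qed

sublocale symmetric_darts "darts G"
  by unfold_locales (rule finite_darts, auto simp: darts_def insert_commute)

lemma nbrs_iff: "u \<in> nbrs G v \<longleftrightarrow> (v, u) \<in> darts G"
  by (simp add: nbrs_def darts_def)

lemma finite_nbrs: "finite (nbrs G v)"
  by (rule finite_subset[OF _ finite_verts]) (auto simp: nbrs_iff dest: dart_verts)

lemma outflow_fst: "outflow fst c v = (\<Sum>u\<in>nbrs G v. c (v, u))"
  unfolding outflow_def
  by (rule sum.reindex_bij_witness[where i = "\<lambda>u. (v, u)" and j = snd]) (auto simp: nbrs_iff)

lemma card_darts: "card (darts G) = 2 * card (edges G)"
proof -
  let ?e = "\<lambda>d. {fst d, snd d}"
  have "finite (edges G)"
    using simple by (auto simp: simple_graph_def intro: finite_subset[of _ "Pow (verts G)"])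
  then have "(\<Sum>e\<in>edges G. \<Sum>d | d \<in> darts G \<and> ?e d = e. 1) = (\<Sum>d\<in>darts G. 1::nat)"
    by (intro sum.group finite_darts) (auto simp: darts_def)
  moreover have "(\<Sum>d | d \<in> darts G \<and> ?e d = e. 1) = (2::nat)" if "e \<in> edges G" for e
  proof -
    obtain a b where ab: "e = {a, b}" "a \<noteq> b"
      using \<open>e \<in> edges G\<close> simple by (auto simp: simple_graph_def card_2_iff)
    then have "{d. d \<in> darts G \<and> ?e d = e} = {(a, b), (b, a)}"
      using \<open>e \<in> edges G\<close> by (auto simp: darts_def doubleton_eq_iff insert_commute)
    then show ?thesis
      using ab by simp
  qed
  ultimately show ?thesis
    by simp
qed

lemma antisymmetric_dart_force: "antisymmetric (dart_force p w)"
  unfolding antisymmetric_def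
proof
  fix d
  show "dart_force p w (prod.swap d) = - dart_force p w d"
    using extensor_anticomm[of "p (snd d)" "p (fst d)"]
    by (cases d) (simp add: dart_force_def insert_commute)
qed

lemma outflow_dart_force: "outflow fst (dart_force p w) v = joint_force G p w v"
  by (simp add: outflow_fst joint_force_def)

lemma joint_force_outside: "v \<notin> verts G \<Longrightarrow> joint_force G p w v = 0"
  unfolding joint_force_def by (rule sum.neutral) (auto simp: nbrs_iff dest: dart_verts)

text \<open>Each bar pulls its two joints with opposite forces.\<close>

lemma sum_joint_force: "(\<Sum>v\<in>verts G. joint_force G p w v) = 0"
proof -
  have "(\<Sum>v\<in>verts G. joint_force G p w v) = (\<Sum>v\<in>fst ` darts G. joint_force G p w v)"
  proof (rule sum.mono_neutral_right)
    show "fst ` darts G \<subseteq> verts G"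
      using dart_verts by auto
    show "\<forall>v\<in>verts G - fst ` darts G. joint_force G p w v = 0"
    proof
      fix v
      assume "v \<in> verts G - fst ` darts G"
      then have "nbrs G v = {}"
        by (force simp: nbrs_iff)
      then show "joint_force G p w v = 0"
        by (simp add: joint_force_def)
    qed
  qed (rule finite_verts)
  also have "\<dots> = (\<Sum>d\<in>darts G. dart_force p w d)"
    using sum_outflow[of fst "dart_force p w"] by (simp add: outflow_dart_force)
  also have "\<dots> = 0"
    by (rule sum_antisymmetric[OF antisymmetric_dart_force])
  finally show ?thesis .
qed

end

section \<open>Circulations on the sphere\<close>

locale spherical_drawing =
  fixes P :: "('v, 'z) drawing_scheme"
  assumes spherical: "spherical_polyhedron P"
begin

lemma three_conn: "three_connected P"
  and rotation: "rotation_system P"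
  and euler: "int (card (verts P)) - int (card (edges P)) + int (card (faces P)) = 2"
  using spherical by (auto simp: spherical_polyhedron_def)

sublocale simple_graph_darts P
  using spherical by unfold_locales (simp add: spherical_polyhedron_def)

lemma cw_nbrs: "v \<in> verts P \<Longrightarrow> bij_betw (cw P v) (nbrs P v) (nbrs P v)"
  using rotation by (simp add: rotation_system_def)

lemma bij_betw_face_next: "bij_betw (face_next P) (darts P) (darts P)"
proof -
  have "face_next P ` darts P \<subseteq> darts P"
  proof (clarify, simp only: face_next_def fst_conv snd_conv)
    fix u v
    assume "(u, v) \<in> darts P"
    then have "v \<in> verts P" "u \<in> nbrs P v"
      using dart_verts swap_D by (auto simp: nbrs_iff)
    then show "(v, cw P v u) \<in> darts P"
      using cw_nbrs bij_betwE by (fastforce simp: nbrs_iff)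
  qed
  moreover have "inj_on (face_next P) (darts P)"
  proof (rule inj_onI)
    fix d e
    assume d: "d \<in> darts P" and e: "e \<in> darts P" and "face_next P d = face_next P e"
    then have eq: "snd e = snd d" "cw P (snd d) (fst d) = cw P (snd d) (fst e)"
      by (auto simp: face_next_def)
    have "snd d \<in> verts P" "fst d \<in> nbrs P (snd d)" "fst e \<in> nbrs P (snd d)"
      using d e eq(1) dart_verts[of "fst d" "snd d"] swap_D[OF d] swap_D[OF e]
      by (simp_all add: nbrs_iff prod.swap_def)
    then have "fst d = fst e"
      using eq(2) cw_nbrs by (meson bij_betw_imp_inj_on inj_onD)
    then show "d = e"
      using eq(1) by (simp add: prod_eq_iff)
  qed
  ultimately show ?thesis
    by (simp add: bij_betw_def endo_inj_surj finite_darts)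
qed

lemma face_next_dart: "d \<in> darts P \<Longrightarrow> face_next P d \<in> darts P"
  using bij_betw_face_next bij_betwE by blast

text \<open>Since \<open>face_next\<close> permutes the finitely many darts, tracing a face comes back to the dart it
  started with, and the faces partition the darts.\<close>

lemma self_in_left_face:
  assumes "d \<in> darts P"
  shows "d \<in> left_face P d"
proof -
  let ?f = "perm_restrict (face_next P) (darts P)"
  have "bij_betw ?f (darts P) (darts P)"
    using bij_betw_face_next by (simp add: perm_restrict_simps cong: bij_betw_cong)
  then have "?f permutes darts P"
    by (rule bij_imp_permutes) (simp add: perm_restrict_simps)
  then have "permutation ?f"
    using finite_darts by (auto simp: permutation_permutes)
  then have "d \<in> orbit ?f d"
    by (rule permutation_self_in_orbit)
  also have "orbit ?f d = orbit (face_next P) d"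
    using assms by (rule orbit_cong0) (auto simp: perm_restrict_simps face_next_dart)
  finally show ?thesis
    by (simp add: left_face_def)
qed

lemma left_face_next: "d \<in> darts P \<Longrightarrow> left_face P (face_next P d) = left_face P d"
  using self_in_left_face self_in_orbit_step unfolding left_face_def by metis

lemma left_face_member:
  assumes "e \<in> left_face P d" "d \<in> darts P"
  shows "e \<in> darts P \<and> left_face P e = left_face P d"
  using assms unfolding left_face_def
proof (induction rule: orbit.induct)
  case base
  then show ?case
    using left_face_next face_next_dart by (simp add: left_face_def)
next
  case (step e)
  then show ?case
    using left_face_next[of e] face_next_dart[of e] by (simp add: left_face_def)
qed

lemma face_member: "F \<in> faces P \<Longrightarrow> d \<in> F \<Longrightarrow> d \<in> darts P \<and> left_face P d = F"
  using left_face_member unfolding faces_def by blast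

lemma left_face_in_faces: "d \<in> darts P \<Longrightarrow> left_face P d \<in> faces P"
  by (simp add: faces_def)

lemma left_face_cw: "(v, u) \<in> darts P \<Longrightarrow> left_face P (v, cw P v u) = right_face P (v, u)"
  using left_face_next[of "(u, v)"] swap_D[of "(v, u)"] by (simp add: right_face_def face_next_def)

text \<open>Turning around a vertex, one leaves every face through the dart next to the one through
  which it was entered; so potential differences of faces telescope there.  Likewise potential
  differences of vertices telescope along the boundary of a face.\<close>

lemma face_difference_outflow:
  assumes "v \<in> verts P"
  shows "outflow fst (\<lambda>d. S (left_face P d) - S (right_face P d)) v = 0"
proof -
  have "(\<Sum>u\<in>nbrs P v. S (left_face P (v, u))) = (\<Sum>u\<in>nbrs P v. S (left_face P (v, cw P v u)))"
    by (rule sum.reindex_bij_betw[symmetric, OF cw_nbrs[OF assms]])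
  also have "\<dots> = (\<Sum>u\<in>nbrs P v. S (right_face P (v, u)))"
    by (simp add: left_face_cw nbrs_iff)
  finally show ?thesis
    by (simp add: outflow_fst sum_subtractf)
qed

lemma vertex_difference_outflow: "outflow (left_face P) (\<lambda>d. h (fst d) - h (snd d)) F = 0"
proof -
  let ?A = "{d. d \<in> darts P \<and> left_face P d = F}"
  have "bij_betw (face_next P) ?A ?A"
  proof (rule bij_betw_imageI)
    have "inj_on (face_next P) (darts P)"
      using bij_betw_face_next by (rule bij_betw_imp_inj_on)
    then show inj: "inj_on (face_next P) ?A"
      by (rule inj_on_subset) auto
    have "face_next P ` ?A \<subseteq> ?A"
      by (auto simp: face_next_dart left_face_next simp del: split_paired_All)
    then show "face_next P ` ?A = ?A"
      using inj finite_darts by (intro endo_inj_surj) auto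
  qed
  from sum.reindex_bij_betw[OF this, of "\<lambda>d. h (fst d)"]
  have "(\<Sum>d\<in>?A. h (snd d)) = (\<Sum>d\<in>?A. h (fst d))"
    by (simp add: face_next_def)
  then show ?thesis
    by (simp add: outflow_def sum_subtractf)
qed

lemma connected_verts:
  assumes "r \<in> W" "W \<subseteq> verts P" "\<And>u v. (u, v) \<in> darts P \<Longrightarrow> u \<in> W \<Longrightarrow> v \<in> W"
  shows "W = verts P"
proof -
  have "connected_within P (verts P - {})"
    using three_conn unfolding three_connected_def by (metis card.empty empty_subsetI le0)
  then have "(r, v) \<in> {(x, y). x \<in> verts P \<and> y \<in> verts P \<and> {x, y} \<in> edges P}\<^sup>*"
    if "v \<in> verts P" for v
    using that assms(1,2) by (auto simp: connected_within_def)
  moreover have "v \<in> W" if "(r, v) \<in> {(x, y). x \<in> verts P \<and> y \<in> verts P \<and> {x, y} \<in> edges P}\<^sup>*" for v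
    using that by (induction rule: rtrancl_induct) (use assms(1,3) in \<open>auto simp: darts_def\<close>)
  ultimately show ?thesis
    using assms(2) by blast
qed

text \<open>If a set of faces is closed under adjacency, then all faces at a vertex belong to it as soon
  as one of them does; so connectedness passes from the vertices to the faces.\<close>

lemma connected_faces:
  assumes "r \<in> W" "W \<subseteq> faces P"
    and closed: "\<And>d. d \<in> darts P \<Longrightarrow> left_face P d \<in> W \<Longrightarrow> right_face P d \<in> W"
  shows "W = faces P"
proof -
  let ?A = "{v \<in> verts P. \<exists>u\<in>nbrs P v. left_face P (v, u) \<in> W}"
  have turn: "left_face P (v, x) \<in> W"
    if "v \<in> verts P" "u \<in> nbrs P v" "left_face P (v, u) \<in> W" "x \<in> nbrs P v" for v u x
  proof -
    have "\<exists>n. x = (cw P v ^^ n) u"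
      using rotation that unfolding rotation_system_def by blast
    then obtain n where "x = (cw P v ^^ n) u"
      by blast
    moreover have "(cw P v ^^ n) u \<in> nbrs P v \<and> left_face P (v, (cw P v ^^ n) u) \<in> W" for n
    proof (induction n)
      case (Suc n)
      then have "(cw P v ((cw P v ^^ n) u)) \<in> nbrs P v"
        using cw_nbrs[OF that(1)] bij_betwE by blast
      moreover have "left_face P (v, cw P v ((cw P v ^^ n) u)) \<in> W"
        using Suc closed by (simp add: left_face_cw nbrs_iff)
      ultimately show ?case
        by simp
    qed (use that in simp)
    ultimately show ?thesis
      by simp
  qed
  obtain d where d: "d \<in> darts P" "r = left_face P d"
    using assms(1,2) by (auto simp: faces_def)
  have "fst d \<in> ?A"
    using d assms(1) dart_verts[of "fst d" "snd d"]
    by (auto simp: nbrs_iff intro!: bexI[where x = "snd d"])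
  then have all: "?A = verts P"
  proof (rule connected_verts)
    fix u v
    assume uv: "(u, v) \<in> darts P" "u \<in> ?A"
    then obtain x where "u \<in> verts P" "x \<in> nbrs P u" "left_face P (u, x) \<in> W"
      by blast
    then have "left_face P (u, v) \<in> W"
      by (rule turn) (use uv(1) in \<open>simp add: nbrs_iff\<close>)
    then have "left_face P (v, u) \<in> W"
      using closed[OF uv(1)] by (simp add: right_face_def)
    moreover have "v \<in> verts P" "u \<in> nbrs P v"
      using dart_verts[OF uv(1)] swap_D[OF uv(1)] by (simp_all add: nbrs_iff)
    ultimately show "v \<in> ?A"
      by blast
  qed simp
  have "left_face P (u, v) \<in> W" if "(u, v) \<in> darts P" for u v
  proof -
    have "u \<in> ?A"
      using all dart_verts[OF that] by simp
    then obtain x where "u \<in> verts P" "x \<in> nbrs P u" "left_face P (u, x) \<in> W"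
      by blast
    then show ?thesis
      by (rule turn) (use that in \<open>simp add: nbrs_iff\<close>)
  qed
  then show ?thesis
    using assms(2) by (auto simp: faces_def)
qed

text \<open>Discrete Poincare lemma on the sphere.  After subtracting a potential difference one may
  assume that the circulation vanishes on a spanning tree of the dual graph.  The edges that
  remain connect all vertices, since a cut avoiding them would be a dual circulation supported on
  the dual tree; and by Euler's formula they are as many as the edges of a spanning tree.  So the
  circulation is supported on a tree.\<close>

lemma circulation_is_face_difference:
  fixes c :: "'v \<times> 'v \<Rightarrow> 'b::real_inner"
  assumes c: "circulation fst c"
  shows "\<exists>S. \<forall>d\<in>darts P. c d = S (left_face P d) - S (right_face P d)"
proof (cases "darts P = {}")
  case False
  then obtain d0 where d0: "d0 \<in> darts P"
    by blast
  have "\<exists>T. tree (left_face P) (left_face P d0) (faces P) T"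
    using d0 connected_faces
    by (intro spanning_tree) (auto simp: left_face_in_faces right_face_def faces_def finite_darts)
  then obtain T where T: "tree (left_face P) (left_face P d0) (faces P) T"
    by blast
  obtain S where S: "\<forall>d\<in>T. c d = S (left_face P d) - S (right_face P d)"
    using tree_potential[OF T, of c] c unfolding circulation_def right_face_def by blast
  let ?c = "\<lambda>d. c d - (S (left_face P d) - S (right_face P d))"
  have c': "circulation fst ?c"
    unfolding circulation_def
  proof (intro conjI ballI)
    show "antisymmetric ?c"
      using c by (auto simp: circulation_def antisymmetric_def right_face_def)
    fix d
    assume d: "d \<in> darts P"
    have "outflow fst ?c (fst d) = outflow fst c (fst d) -
        outflow fst (\<lambda>d. S (left_face P d) - S (right_face P d)) (fst d)"
      by (simp add: outflow_def sum_subtractf)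
    moreover have "fst d \<in> verts P"
      using d dart_verts[of "fst d" "snd d"] by simp
    ultimately show "outflow fst ?c (fst d) = 0"
      using c d face_difference_outflow[of "fst d" S] by (simp only: circulation_def) simp
  qed
  have T_swap: "prod.swap d \<in> T \<longleftrightarrow> d \<in> T" for d
    using tree_darts(4)[OF T, of d] tree_darts(4)[OF T, of "prod.swap d"] by auto
  interpret R: symmetric_darts "darts P - T"
    by unfold_locales (use finite_darts T_swap swap_D in \<open>blast+\<close>)
  have "\<exists>T'. R.tree fst (fst d0) (verts P) T'"
  proof (rule R.spanning_tree)
    show "finite (verts P)"
      using simple by (simp add: simple_graph_def)
    show "fst d0 \<in> verts P" "\<And>d. d \<in> darts P - T \<Longrightarrow> fst d \<in> verts P"
      using dart_verts d0 by (auto, metis prod.collapse)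
  next
    fix W
    assume W: "fst d0 \<in> W" "W \<subseteq> verts P"
      "\<And>d. d \<in> darts P - T \<Longrightarrow> fst d \<in> W \<Longrightarrow> fst (prod.swap d) \<in> W"
    let ?h = "\<lambda>v. if v \<in> W then 1 else (0::real)"
    let ?g = "\<lambda>d. ?h (fst d) - ?h (snd d)"
    have "circulation (left_face P) ?g"
      using vertex_difference_outflow[of ?h] by (simp add: circulation_def antisymmetric_def)
    moreover have "?g d = 0" if "d \<in> darts P" "d \<notin> T" for d
      using W(3)[of d] W(3)[of "prod.swap d"] that swap_D[of d] T_swap[of d] by auto
    ultimately have "?g d = 0" if "d \<in> darts P" for d
      using circulation_on_tree[OF T, of ?g d] that by blast
    then have "u \<in> W \<Longrightarrow> v \<in> W" if "(u, v) \<in> darts P" for u v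
      using that by (fastforce split: if_splits)
    then show "W = verts P"
      using connected_verts[OF W(1,2)] by blast
  qed
  then obtain T' where T': "R.tree fst (fst d0) (verts P) T'"
    by blast
  \<comment> \<open>Euler's formula: both sides have \<open>2 * (card (verts P) - 1)\<close> darts.\<close>
  have "T' = darts P - T"
  proof (rule card_subset_eq)
    show "finite (darts P - T)"
      by (simp add: finite_darts)
    show "T' \<subseteq> darts P - T"
      by (rule R.tree_darts(1)[OF T'])
    have "card (darts P - T) = card (darts P) - card T"
      using tree_darts(1)[OF T] tree_card[OF T] by (simp add: card_Diff_subset)
    then show "card T' = card (darts P - T)"
      using tree_card[OF T] R.tree_card[OF T'] card_darts euler by linarith
  qed
  moreover have "R.circulation fst ?c"
    unfolding R.circulation_def
  proof (intro conjI ballI)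
    show "R.antisymmetric ?c"
      using c' by (simp add: circulation_def antisymmetric_def R.antisymmetric_def)
    fix d
    assume d: "d \<in> darts P - T"
    have "R.outflow fst ?c (fst d) = outflow fst ?c (fst d)"
      unfolding R.outflow_def outflow_def
      by (rule sum.mono_neutral_left) (use S finite_darts in auto)
    then show "R.outflow fst ?c (fst d) = 0"
      using c' d by (simp add: circulation_def)
  qed
  ultimately have "?c d = 0" if "d \<in> darts P - T" for d
    using R.circulation_on_tree[OF T', of ?c d] that by blast
  then show ?thesis
    using S by (intro exI[where x = S]) auto
qed simp

text \<open>An edge with the same face on both sides carries no circulation, by
  \<open>circulation_is_face_difference\<close>; but its ends are joined by a path avoiding it, which closes
  up to a cycle through it.\<close>

lemma left_face_ne_right_face:
  assumes "d \<in> darts P"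
  shows "left_face P d \<noteq> right_face P d"
proof -
  obtain i j where ij: "d = (i, j)"
    by (cases d)
  have verts: "i \<in> verts P" "j \<in> verts P" "i \<noteq> j"
    using dart_verts assms ij by auto
  have "card {i, j} < card (verts P)"
    using three_conn card_insert_le_m1[of 2 "{j}" i] by (simp add: three_connected_def)
  then obtain w where w: "w \<in> verts P" "w \<noteq> i" "w \<noteq> j"
    by (metis card_mono finite.emptyI finite.insertI insertCI not_less subsetI)
  define R where "R x = {(u, v). u \<in> verts P - {x} \<and> v \<in> verts P - {x} \<and> {u, v} \<in> edges P}" for x
  have "\<exists>f. antisymmetric f \<and> (\<forall>d. d \<notin> R x \<longrightarrow> f d = 0) \<and> (\<forall>v. outflow fst f v =
      (if v = a then 1 else (0::real)) - (if v = b then 1 else 0))"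
    if "x \<in> verts P" "a \<in> verts P - {x}" "b \<in> verts P - {x}" for x a b
  proof (rule path_flow)
    have "connected_within P (verts P - {x})"
      using three_conn that(1) by (simp add: three_connected_def)
    then show "(a, b) \<in> (R x)\<^sup>*"
      using that by (simp add: connected_within_def R_def)
    show "R x \<subseteq> darts P" "sym (R x)"
      by (auto simp: R_def darts_def sym_def insert_commute)
  qed
  note flow = this
  obtain f where f: "antisymmetric f" "\<forall>d. d \<notin> R i \<longrightarrow> f d = 0"
    "\<forall>v. outflow fst f v = (if v = j then 1 else (0::real)) - (if v = w then 1 else 0)"
    using flow[of i j w] verts w by blast
  obtain g where g: "antisymmetric g" "\<forall>d. d \<notin> R j \<longrightarrow> g d = 0"
    "\<forall>v. outflow fst g v = (if v = w then 1 else (0::real)) - (if v = i then 1 else 0)"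
    using flow[of j w i] verts w by blast
  \<comment> \<open>A unit flow round a cycle from \<open>i\<close> to \<open>j\<close> through the edge, on to \<open>w\<close> avoiding \<open>i\<close>, and back
    to \<open>i\<close> avoiding \<open>j\<close>.\<close>
  let ?c = "\<lambda>d. edge_flow 1 i j d + (f d + g d)"
  have "circulation fst ?c"
    using f g outflow_edge_flow[of i j "1::real"] antisymmetric_edge_flow[of "1::real" i j] assms ij
    by (auto simp: circulation_def antisymmetric_def outflow_def sum.distrib)
  then obtain S where "?c d = S (left_face P d) - S (right_face P d)"
    using circulation_is_face_difference assms by blast
  moreover have "?c d = 1"
    using f(2) g(2) verts by (simp add: edge_flow_def ij R_def)
  ultimately show ?thesis
    by auto
qed

end

section \<open>Motion assignments of the swapped polyhedron\<close>

locale separated_polyhedron =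
  fixes P :: "'v bh_poly"
  assumes block_hole: "block_hole_polyhedron P"
    and sep: "separated P"
begin

sublocale spherical_drawing P
  using block_hole by unfold_locales (simp add: block_hole_polyhedron_def)

text \<open>The free edges are at once the hinges of the swapped structure, see \<open>hinges_swapped\<close>, and
  the bars of the framework that belong to no block.\<close>

definition free_edges :: "'v set set" where
  "free_edges = edges P - (\<Union>B\<in>blocks P. face_edges B)"

definition off_blocks :: "'v \<Rightarrow> bool" where
  "off_blocks v \<longleftrightarrow> v \<in> verts P \<and> (\<forall>B\<in>blocks P. v \<notin> face_verts B)"

lemma block_face: "B \<in> blocks P \<Longrightarrow> B \<in> faces P"
  using block_hole by (auto simp: block_hole_polyhedron_def)

lemma finite_blocks: "finite (blocks P)"
proof (rule finite_subset)
  show "blocks P \<subseteq> faces P"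
    by (auto simp: block_face)
  show "finite (faces P)"
    by (simp add: faces_def finite_darts)
qed

lemma face_verts_snd:
  assumes "F \<in> faces P" "d \<in> F"
  shows "snd d \<in> face_verts F"
proof -
  have d: "d \<in> darts P" "left_face P d = F"
    using face_member[OF assms] by auto
  then have "face_next P d \<in> F"
    using self_in_left_face[OF face_next_dart[OF d(1)]] left_face_next[OF d(1)] by simp
  then have "fst (face_next P d) \<in> face_verts F"
    unfolding face_verts_def by (rule imageI)
  then show ?thesis
    by (simp add: face_next_def)
qed

lemma face_edges_iff: "{u, v} \<in> face_edges F \<longleftrightarrow> (u, v) \<in> F \<or> (v, u) \<in> F"
  by (force simp: face_edges_def doubleton_eq_iff)

lemma face_edges_verts:
  assumes "F \<in> faces P" "{u, v} \<in> face_edges F"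
  shows "u \<in> face_verts F" "v \<in> face_verts F"
  using assms face_verts_snd[OF assms(1)] by (force simp: face_edges_iff face_verts_def)+

lemma face_verts_subset: "F \<in> faces P \<Longrightarrow> face_verts F \<subseteq> verts P"
  using face_member dart_verts by (fastforce simp: face_verts_def)

lemma finite_face_verts: "F \<in> faces P \<Longrightarrow> finite (face_verts F)"
  using face_verts_subset finite_verts finite_subset by blast

lemma block_unique:
  "B \<in> blocks P \<Longrightarrow> C \<in> blocks P \<Longrightarrow> v \<in> face_verts B \<Longrightarrow> v \<in> face_verts C \<Longrightarrow> B = C"
  using sep face_verts_subset[OF block_face] unfolding separated_def by blast

lemma member_face_iff: "F \<in> faces P \<Longrightarrow> d \<in> darts P \<Longrightarrow> d \<in> F \<longleftrightarrow> left_face P d = F"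
  using face_member self_in_left_face by blast

lemma free_edge_iff:
  assumes "(u, v) \<in> darts P"
  shows "{u, v} \<in> free_edges \<longleftrightarrow> left_face P (u, v) \<notin> blocks P \<and> right_face P (u, v) \<notin> blocks P"
proof -
  have "{u, v} \<in> edges P" "(v, u) \<in> darts P"
    using assms swap_D by (auto simp: darts_def)
  then show ?thesis
    using assms by (auto simp: free_edges_def face_edges_iff member_face_iff block_face right_face_def)
qed

lemma darts_swapped: "darts (swapped P) = darts P"
  and left_face_swapped: "left_face (swapped P) = left_face P"
  and right_face_swapped: "right_face (swapped P) = right_face P"
  and faces_swapped: "faces (swapped P) = faces P"
  by (simp_all add: fun_eq_iff darts_def left_face_def right_face_def faces_def face_next_def[abs_def]
      swapped_def)

lemma bodies_swapped: "bodies (swapped P) = faces P - blocks P"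
  using block_hole
  by (auto simp: bodies_def surface_faces_def faces_swapped block_hole_polyhedron_def)
    (auto simp: swapped_def)

lemma hinges_swapped: "hinges (swapped P) = free_edges"
proof (intro set_eqI iffI)
  fix e
  assume "e \<in> hinges (swapped P)"
  then show "e \<in> free_edges"
    by (auto simp: hinges_def darts_swapped left_face_swapped right_face_swapped bodies_swapped
        free_edge_iff)
next
  fix e
  assume e: "e \<in> free_edges"
  then obtain i j where ij: "e = {i, j}"
    using simple by (auto simp: free_edges_def simple_graph_def card_2_iff)
  then have d: "(i, j) \<in> darts P" "(j, i) \<in> darts P"
    using e by (auto simp: free_edges_def darts_def insert_commute)
  then show "e \<in> hinges (swapped P)"
    using e ij free_edge_iff[OF d(1)] left_face_in_faces[OF d(1)] left_face_in_faces[OF d(2)]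
      left_face_ne_right_face[OF d(1)]
    by (auto simp: hinges_def darts_swapped left_face_swapped right_face_swapped bodies_swapped
        right_face_def)
qed

text \<open>The potential of a face is the screw motion of the corresponding body; on the blocks of \<open>P\<close>,
  which are holes of the swapped polyhedron, its values are arbitrary.\<close>

lemma motion_iff_potential:
  "w \<in> motion_assignments (swapped P) p \<longleftrightarrow>
    (\<forall>e. e \<notin> free_edges \<longrightarrow> w e = 0) \<and>
    (\<exists>S. \<forall>(i, j)\<in>darts P. {i, j} \<in> free_edges \<longrightarrow>
      dart_force p w (i, j) = S (left_face P (i, j)) - S (right_face P (i, j)))"
  (is "_ \<longleftrightarrow> ?supp \<and> ?pot")
proof -
  let ?H = "{d \<in> darts P. {fst d, snd d} \<in> free_edges}"
  let ?cyc = "\<lambda>ds. set ds \<subseteq> ?H \<and> map (left_face P) ds = map (right_face P) (rotate1 ds)"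
  have cyc: "closed_body_cycle (swapped P) ds \<longleftrightarrow> ?cyc ds" for ds
    by (auto simp: closed_body_cycle_def hinges_swapped left_face_swapped right_face_swapped
        darts_def free_edges_def)
  have motion: "w \<in> motion_assignments (swapped P) p \<longleftrightarrow>
      ?supp \<and> (\<forall>ds. ?cyc ds \<longrightarrow> (\<Sum>d\<leftarrow>ds. dart_force p w d) = 0)"
    by (simp add: motion_assignments_def hinges_swapped cyc dart_force_def)
  interpret H: symmetric_darts ?H
    by unfold_locales (use finite_darts swap_D in \<open>auto simp: insert_commute\<close>)
  have "(\<forall>ds. ?cyc ds \<longrightarrow> (\<Sum>d\<leftarrow>ds. dart_force p w d) = 0) \<longleftrightarrow> ?pot"
  proof
    assume zero: "\<forall>ds. ?cyc ds \<longrightarrow> (\<Sum>d\<leftarrow>ds. dart_force p w d) = 0"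
    have "\<exists>S. \<forall>d\<in>?H. dart_force p w d = S (left_face P d) - S (left_face P (prod.swap d))"
    proof (rule H.closed_walks_zero_imp_potential)
      show "H.antisymmetric (dart_force p w)"
        using antisymmetric_dart_force[of p w] by (simp add: antisymmetric_def H.antisymmetric_def)
      fix a ds
      assume walk: "H.walk (left_face P) a ds a"
      have "map (left_face P) ds = map (right_face P) (rotate1 ds)"
        using H.closed_walk_rotate1[OF walk] by (simp add: right_face_def comp_def)
      then show "(\<Sum>d\<leftarrow>ds. dart_force p w d) = 0"
        using zero H.walk_darts[OF walk] by blast
    qed
    then show ?pot
      by (auto simp: right_face_def)
  next
    assume ?pot
    then obtain S where S: "\<forall>d\<in>?H. dart_force p w d = S (left_face P d) - S (right_face P d)"
      by auto
    show "\<forall>ds. ?cyc ds \<longrightarrow> (\<Sum>d\<leftarrow>ds. dart_force p w d) = 0"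
    proof (intro allI impI)
      fix ds
      assume ds: "?cyc ds"
      then have "(\<Sum>d\<leftarrow>ds. dart_force p w d) =
          (\<Sum>d\<leftarrow>ds. S (left_face P d) - S (right_face P d))"
        using S by (intro arg_cong[where f = sum_list] map_cong) auto
      also have "\<dots> = sum_list (map S (map (left_face P) ds)) - (\<Sum>d\<leftarrow>ds. S (right_face P d))"
        by (simp add: sum_list_subtractf comp_def)
      also have "sum_list (map S (map (left_face P) ds)) = (\<Sum>d\<leftarrow>rotate1 ds. S (right_face P d))"
        using ds by (simp add: comp_def del: map_map) (simp add: comp_def)
      also have "\<dots> = (\<Sum>d\<leftarrow>ds. S (right_face P d))"
        by (cases ds) (simp_all add: add.commute)
      finally show "(\<Sum>d\<leftarrow>ds. dart_force p w d) = 0"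
        by simp
    qed
  qed
  then show ?thesis
    using motion by blast
qed

text \<open>The boundary of a face is connected, so it can carry any load of total zero on its vertices
  to a single one of them.\<close>

lemma face_boundary_flow:
  fixes L :: "'v \<Rightarrow> 'b::real_vector"
  assumes F: "F \<in> faces P" and sum: "(\<Sum>v\<in>face_verts F. L v) = 0"
  shows "\<exists>f. antisymmetric f \<and> (\<forall>u v. {u, v} \<notin> face_edges F \<longrightarrow> f (u, v) = 0) \<and>
    (\<forall>v. outflow fst f v = (if v \<in> face_verts F then L v else 0))"
proof -
  let ?R = "{(u, v). {u, v} \<in> face_edges F}"
  \<comment> \<open>All vertices are connected within the boundary to \<open>fst d0\<close>, which collects the loads.\<close>
  obtain d0 where d0: "d0 \<in> darts P" "F = left_face P d0"
    using F by (auto simp: faces_def)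
  have "sym ?R"
    by (auto simp: sym_def insert_commute)
  have "?R \<subseteq> darts P"
  proof clarify
    fix u v
    assume "{u, v} \<in> face_edges F"
    then have "(u, v) \<in> darts P \<or> (v, u) \<in> darts P"
      using face_member[OF F] by (auto simp: face_edges_iff)
    then show "(u, v) \<in> darts P"
      using swap_D[of "(v, u)"] by auto
  qed
  have step: "(fst d, snd d) \<in> ?R" if "d \<in> F" for d
    using that by (cases d) (simp add: face_edges_iff)
  have "d \<in> F \<and> (fst d0, fst d) \<in> ?R\<^sup>*" if "d \<in> left_face P d0" for d
    using that unfolding left_face_def
  proof (induction rule: orbit.induct)
    case base
    have "face_next P d0 \<in> F"
      using d0(2) by (simp add: left_face_def orbit.base)
    moreover have "d0 \<in> F"
      using d0 self_in_left_face by blast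
    ultimately show ?case
      using step[of d0] by (auto simp: face_next_def)
  next
    case (step d)
    then have "face_next P d \<in> F"
      using d0(2) by (auto simp: left_face_def intro: orbit.step)
    then show ?case
      using step \<open>\<And>d. d \<in> F \<Longrightarrow> (fst d, snd d) \<in> ?R\<close>[of d]
      by (auto simp: face_next_def intro: rtrancl_into_rtrancl)
  qed
  then have conn: "(v, fst d0) \<in> ?R\<^sup>*" if "v \<in> face_verts F" for v
    using that d0(2) sym_rtrancl[OF \<open>sym ?R\<close>] by (auto simp: face_verts_def dest: symD)
  have "\<forall>v\<in>face_verts F. \<exists>f. antisymmetric f \<and> (\<forall>d. d \<notin> ?R \<longrightarrow> f d = 0) \<and>
      (\<forall>u. outflow fst f u = (if u = v then L v else 0) - (if u = fst d0 then L v else 0))"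
    using path_flow[OF conn \<open>?R \<subseteq> darts P\<close> \<open>sym ?R\<close>] by blast
  from bchoice[OF this] obtain f where f: "\<forall>v\<in>face_verts F. antisymmetric (f v) \<and>
      (\<forall>d. d \<notin> ?R \<longrightarrow> f v d = 0) \<and>
      (\<forall>u. outflow fst (f v) u = (if u = v then L v else 0) - (if u = fst d0 then L v else 0))"
    by blast
  let ?f = "\<lambda>d. \<Sum>v\<in>face_verts F. f v d"
  have "outflow fst ?f u = (if u \<in> face_verts F then L u else 0)" for u
  proof -
    have "outflow fst ?f u = (\<Sum>v\<in>face_verts F. outflow fst (f v) u)"
      unfolding outflow_def by (rule sum.swap)
    also have "\<dots> = (\<Sum>v\<in>face_verts F. if u = v then L v else 0) -
        (if u = fst d0 then \<Sum>v\<in>face_verts F. L v else 0)"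
      using f by (simp add: sum_subtractf)
    also have "\<dots> = (if u \<in> face_verts F then L u else 0)"
      using sum finite_face_verts[OF F] by simp
    finally show ?thesis .
  qed
  moreover have "antisymmetric ?f"
    using f by (simp add: antisymmetric_def sum_negf)
  moreover have "\<forall>u v. {u, v} \<notin> face_edges F \<longrightarrow> ?f (u, v) = 0"
    using f by (auto intro!: sum.neutral)
  ultimately show ?thesis
    by (intro exI[where x = ?f]) blast
qed

text \<open>The cycle conditions reduce to one for each vertex off the blocks and one for each block.  Given
  a potential, the forces differ from the potential differences only on the boundaries of blocks,
  by an antisymmetric function; summed over all vertices of a block this discrepancy cancels.
  Conversely, if the forces around a block sum to zero, a flow along its boundary completes them
  to a circulation of the whole drawing, and the sphere provides a potential.\<close>

lemma motion_assignments_swapped_iff: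
  "w \<in> motion_assignments (swapped P) p \<longleftrightarrow>
    (\<forall>e. e \<notin> free_edges \<longrightarrow> w e = 0) \<and>
    (\<forall>v. off_blocks v \<longrightarrow> joint_force P p w v = 0) \<and>
    (\<forall>B\<in>blocks P. (\<Sum>v\<in>face_verts B. joint_force P p w v) = 0)"
  (is "?motion \<longleftrightarrow> ?supp \<and> ?off \<and> ?on")
proof
  let ?c = "dart_force p w"
  assume ?motion
  then obtain S where ?supp and S: "\<forall>(i, j)\<in>darts P. {i, j} \<in> free_edges \<longrightarrow>
      ?c (i, j) = S (left_face P (i, j)) - S (right_face P (i, j))"
    unfolding motion_iff_potential by blast
  let ?g = "\<lambda>d. ?c d - (S (left_face P d) - S (right_face P d))"
  have g_free: "?g (u, v) = 0" if "(u, v) \<in> darts P" "{u, v} \<in> free_edges" for u v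
    using S that by fastforce
  have force: "joint_force P p w v = outflow fst ?g v" if "v \<in> verts P" for v
  proof -
    have "outflow fst ?g v = outflow fst ?c v -
        outflow fst (\<lambda>d. S (left_face P d) - S (right_face P d)) v"
      by (simp add: outflow_def sum_subtractf)
    then show ?thesis
      using face_difference_outflow[OF that, of S] by (simp add: outflow_dart_force)
  qed
  have ?off
  proof (intro allI impI)
    fix v
    assume v: "off_blocks v"
    have "?g (v, u) = 0" if "u \<in> nbrs P v" for u
    proof (rule g_free)
      show "(v, u) \<in> darts P"
        using that by (simp add: nbrs_iff)
      then show "{v, u} \<in> free_edges"
        using v face_edges_verts(1)[OF block_face]
        by (auto simp: free_edges_def off_blocks_def darts_def)
    qed
    then have "outflow fst ?g v = 0"
      by (simp add: outflow_fst)
    then show "joint_force P p w v = 0"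
      using v force by (simp add: off_blocks_def)
  qed
  moreover have ?on
  proof
    fix B
    assume B: "B \<in> blocks P"
    note BF = block_face[OF B]
    \<comment> \<open>At the vertices of \<open>B\<close> the discrepancy \<open>?g\<close> lives on the boundary darts \<open>?A\<close> of \<open>B\<close> alone,
      because no other block meets these vertices.\<close>
    let ?A = "{d \<in> darts P. {fst d, snd d} \<in> face_edges B}"
    interpret A: symmetric_darts ?A
      by unfold_locales (use finite_darts swap_D in \<open>auto simp: insert_commute\<close>)
    have "outflow fst ?g v = A.outflow fst ?g v" if v: "v \<in> face_verts B" for v
      unfolding outflow_def A.outflow_def
    proof (rule sum.mono_neutral_right)
      show "\<forall>d\<in>{d. d \<in> darts P \<and> fst d = v} - {d. d \<in> ?A \<and> fst d = v}. ?g d = 0"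
      proof
        fix d
        assume d: "d \<in> {d. d \<in> darts P \<and> fst d = v} - {d. d \<in> ?A \<and> fst d = v}"
        then obtain u where u: "d = (v, u)" "(v, u) \<in> darts P" "{v, u} \<notin> face_edges B"
          by (cases d) auto
        have "{v, u} \<notin> face_edges C" if "C \<in> blocks P" for C
          using u(3) v face_edges_verts(1)[OF block_face[OF that]] block_unique[OF B that] by blast
        then have "{v, u} \<in> free_edges"
          using u(2) by (auto simp: free_edges_def darts_def)
        then show "?g d = 0"
          using g_free u by blast
      qed
    qed (use finite_darts in auto)
    then have "(\<Sum>v\<in>face_verts B. joint_force P p w v) = (\<Sum>v\<in>face_verts B. A.outflow fst ?g v)"
      using force face_verts_subset[OF BF] by (intro sum.cong) auto
    also have "\<dots> = (\<Sum>v\<in>fst ` ?A. A.outflow fst ?g v)"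
    proof (rule sum.cong[OF subset_antisym refl])
      show "fst ` ?A \<subseteq> face_verts B"
        using face_edges_verts(1)[OF BF] by auto
      show "face_verts B \<subseteq> fst ` ?A"
        using face_member[OF BF] unfolding face_verts_def
        by (intro image_mono) (auto simp: face_edges_iff)
    qed
    also have "\<dots> = (\<Sum>d\<in>?A. ?g d)"
      by (rule A.sum_outflow)
    also have "\<dots> = 0"
    proof (rule A.sum_antisymmetric)
      show "A.antisymmetric ?g"
        using antisymmetric_dart_force[of p w]
        by (simp add: antisymmetric_def A.antisymmetric_def right_face_def)
    qed
    finally show "(\<Sum>v\<in>face_verts B. joint_force P p w v) = 0" .
  qed
  ultimately show "?supp \<and> ?off \<and> ?on"
    using \<open>?supp\<close> by blast
next
  let ?c = "dart_force p w"
  assume *: "?supp \<and> ?off \<and> ?on"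
  have "\<forall>B\<in>blocks P. \<exists>f. antisymmetric f \<and> (\<forall>u v. {u, v} \<notin> face_edges B \<longrightarrow> f (u, v) = 0) \<and>
      (\<forall>v. outflow fst f v = (if v \<in> face_verts B then - joint_force P p w v else 0))"
    using face_boundary_flow[OF block_face, of _ "\<lambda>v. - joint_force P p w v"] *
    by (simp add: sum_negf)
  from bchoice[OF this] obtain f where f: "\<forall>B\<in>blocks P. antisymmetric (f B) \<and>
      (\<forall>u v. {u, v} \<notin> face_edges B \<longrightarrow> f B (u, v) = 0) \<and>
      (\<forall>v. outflow fst (f B) v = (if v \<in> face_verts B then - joint_force P p w v else 0))"
    by blast
  let ?c' = "\<lambda>d. ?c d + (\<Sum>B\<in>blocks P. f B d)"
  have "outflow fst ?c' v = 0" if v: "v \<in> verts P" for v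
  proof -
    have "outflow fst (\<lambda>d. \<Sum>B\<in>blocks P. f B d) v = (\<Sum>B\<in>blocks P. outflow fst (f B) v)"
      unfolding outflow_def by (rule sum.swap)
    then have sum: "outflow fst ?c' v = joint_force P p w v +
        (\<Sum>B\<in>blocks P. if v \<in> face_verts B then - joint_force P p w v else 0)"
      using f by (simp add: outflow_def sum.distrib flip: outflow_dart_force)
    show ?thesis
    proof (cases "off_blocks v")
      case True
      then show ?thesis
        using sum * by (auto simp: off_blocks_def intro!: sum.neutral)
    next
      case False
      then obtain B where B: "B \<in> blocks P" "v \<in> face_verts B"
        using v by (auto simp: off_blocks_def)
      then have "(v \<in> face_verts C) = (C = B)" if "C \<in> blocks P" for C
        using block_unique that by blast
      then have "(\<Sum>B\<in>blocks P. if v \<in> face_verts B then - joint_force P p w v else 0) =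
          (\<Sum>C\<in>blocks P. if C = B then - joint_force P p w v else 0)"
        by (intro sum.cong) auto
      then show ?thesis
        using sum B(1) finite_blocks by simp
    qed
  qed
  then have "circulation fst ?c'"
    using f antisymmetric_dart_force[of p w] dart_verts
    by (auto simp: circulation_def antisymmetric_def sum_negf)
  then obtain S where S: "\<forall>d\<in>darts P. ?c' d = S (left_face P d) - S (right_face P d)"
    using circulation_is_face_difference by blast
  have "?c (i, j) = S (left_face P (i, j)) - S (right_face P (i, j))"
    if "(i, j) \<in> darts P" "{i, j} \<in> free_edges" for i j
  proof -
    have "(\<Sum>B\<in>blocks P. f B (i, j)) = 0"
      using f that(2) by (intro sum.neutral) (auto simp: free_edges_def)
    then show ?thesis
      using S that(1) by fastforce
  qed
  then show ?motion
    using * unfolding motion_iff_potential by blast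
qed

end

section \<open>Stresses of a block and hole framework\<close>

lemma linear_extensor_left: "linear (\<lambda>x. x \<squnion>\<^sub>e y)"
  by (rule linearI) (simp_all add: vec_eq_iff forall_6 extensor_def vector_6 algebra_simps)

text \<open>All bars at a joint pull along lines through it, so what the free edges exert on the vertices
  of a block is a load in the sense of statics.\<close>

lemma load_at_joint_force: "load_at (p v) (joint_force G p w v)"
proof -
  have "joint_force G p w v = (\<Sum>u\<in>nbrs G v. (- w {v, u} *\<^sub>R p u) \<squnion>\<^sub>e p v)"
    using extensor_anticomm[of "p v"] linear_cmul[OF linear_extensor_left]
    by (simp add: joint_force_def dart_force_def del: scaleR_minus_left)
      (simp add: scaleR_minus_left)
  also have "\<dots> = (\<Sum>u\<in>nbrs G v. - w {v, u} *\<^sub>R p u) \<squnion>\<^sub>e p v"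
    by (rule linear_sum[OF linear_extensor_left, symmetric])
  finally show ?thesis
    by (auto simp: load_at_def)
qed

locale filled_polyhedron = separated_polyhedron P for P :: "'v bh_poly" +
  fixes K :: "('v \<times> 'v) set \<Rightarrow> 'v ugraph" and p q :: "'v \<Rightarrow> real^4"
  assumes filling: "block_filling P p K q"
begin

lemma q_eq_p: "v \<in> verts P \<Longrightarrow> q v = p v"
  using filling by (simp add: block_filling_def)

lemma block_simple: "B \<in> blocks P \<Longrightarrow> simple_graph (K B)"
  and block_isostatic: "B \<in> blocks P \<Longrightarrow> isostatic (K B) q"
  and block_verts: "B \<in> blocks P \<Longrightarrow> verts (K B) \<inter> verts P = face_verts B"
  and block_edges: "B \<in> blocks P \<Longrightarrow> edges (K B) \<inter> edges P = face_edges B"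
  and block_new_verts: "B \<in> blocks P \<Longrightarrow> C \<in> blocks P \<Longrightarrow> C \<noteq> B \<Longrightarrow>
    verts (K B) \<inter> verts (K C) \<subseteq> verts P"
  using filling by (auto simp: block_filling_def framework_def)

lemma block_vert_unique:
  assumes "B \<in> blocks P" "C \<in> blocks P" "v \<in> verts (K B)" "v \<in> verts (K C)"
  shows "B = C"
proof (rule ccontr)
  assume "B \<noteq> C"
  then have "v \<in> verts P"
    using block_new_verts[OF assms(1,2)] assms(3,4) by blast
  then have "v \<in> face_verts B" "v \<in> face_verts C"
    using block_verts assms by blast+
  then show False
    using block_unique assms(1,2) \<open>B \<noteq> C\<close> by blast
qed

lemma block_edge_verts: "B \<in> blocks P \<Longrightarrow> {u, v} \<in> edges (K B) \<Longrightarrow> u \<in> verts (K B)"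
  using block_simple[of B] unfolding simple_graph_def by blast

lemma block_edge_unique:
  assumes "B \<in> blocks P" "C \<in> blocks P" "e \<in> edges (K B)" "e \<in> edges (K C)"
  shows "B = C"
proof -
  obtain v where "v \<in> e" "v \<in> verts (K B)"
    using block_simple[OF assms(1)] assms(3) unfolding simple_graph_def
    by (metis all_not_in_conv card.empty subsetD zero_neq_numeral)
  moreover have "e \<subseteq> verts (K C)"
    using block_simple[OF assms(2)] assms(4) by (simp add: simple_graph_def)
  ultimately show ?thesis
    using block_vert_unique assms(1,2) by blast
qed

lemma free_edges_iff: "e \<in> free_edges \<longleftrightarrow> e \<in> edges P \<and> (\<forall>B\<in>blocks P. e \<notin> edges (K B))"
  using block_edges unfolding free_edges_def by blast

lemma free_edge_not_block: "e \<in> free_edges \<Longrightarrow> B \<in> blocks P \<Longrightarrow> e \<notin> edges (K B)"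
  by (simp add: free_edges_iff)

lemma edges_G_S: "edges (G_S P K) = free_edges \<union> (\<Union>B\<in>blocks P. edges (K B))"
  using block_edges by (auto simp: G_S_def free_edges_def)

lemma off_blocks_iff:
  assumes "v \<in> verts P"
  shows "off_blocks v \<longleftrightarrow> (\<forall>B\<in>blocks P. v \<notin> verts (K B))"
  using assms block_verts unfolding off_blocks_def by blast

lemma verts_G_S: "verts (G_S P K) = {v. off_blocks v} \<union> (\<Union>B\<in>blocks P. verts (K B))"
  using off_blocks_iff by (auto simp: G_S_def off_blocks_def)

definition restrict_free :: "('v set \<Rightarrow> real) \<Rightarrow> 'v set \<Rightarrow> real" where
  "restrict_free l e = (if e \<in> free_edges then l e else 0)"

lemma joint_force_q: "joint_force P q w v = joint_force P p w v"
  unfolding joint_force_def dart_force_def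
  by (rule sum.cong) (auto simp: nbrs_iff q_eq_p dest: dart_verts)

lemma joint_force_off_blocks:
  assumes "off_blocks v"
  shows "joint_force (G_S P K) q l v = joint_force P p (restrict_free l) v"
proof -
  have v: "v \<in> verts P" "\<forall>B\<in>blocks P. v \<notin> verts (K B)"
    using assms off_blocks_iff by (auto simp: off_blocks_def)
  then have nbrs: "nbrs (G_S P K) v = nbrs P v"
    using block_edge_verts by (auto simp: nbrs_def G_S_def)
  moreover have "{v, u} \<in> free_edges" if "u \<in> nbrs P v" for u
    using that v(2) block_edge_verts by (auto simp: free_edges_iff nbrs_def)
  ultimately have "joint_force (G_S P K) q l v = joint_force P q (restrict_free l) v"
    by (simp add: joint_force_def dart_force_def restrict_free_def)
  then show ?thesis
    by (simp add: joint_force_q)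
qed

lemma joint_force_on_block:
  assumes B: "B \<in> blocks P" "v \<in> verts (K B)"
  shows "joint_force (G_S P K) q l v = joint_force P p (restrict_free l) v + joint_force (K B) q l v"
proof -
  interpret K: simple_graph_darts "K B"
    by unfold_locales (rule block_simple[OF B(1)])
  have other: "{v, u} \<notin> edges (K C)" if "C \<in> blocks P" "C \<noteq> B" for C u
    using that block_edge_verts block_vert_unique B by blast
  then have nbrs: "nbrs (G_S P K) v = (nbrs P v - nbrs (K B) v) \<union> nbrs (K B) v"
    using B(1) by (auto simp: nbrs_def G_S_def)
  have free: "{v, u} \<in> free_edges \<longleftrightarrow> u \<notin> nbrs (K B) v" if "u \<in> nbrs P v" for u
    using that other B(1) by (auto simp: free_edges_iff nbrs_def)
  have "joint_force (G_S P K) q l v =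
      (\<Sum>u\<in>nbrs P v - nbrs (K B) v. dart_force q l (v, u)) + joint_force (K B) q l v"
    unfolding joint_force_def nbrs
    by (rule sum.union_disjoint) (auto simp: finite_nbrs K.finite_nbrs)
  also have "(\<Sum>u\<in>nbrs P v - nbrs (K B) v. dart_force q l (v, u)) =
      joint_force P q (restrict_free l) v"
    unfolding joint_force_def
    by (rule sum.mono_neutral_cong_left)
      (auto simp: finite_nbrs dart_force_def restrict_free_def free)
  finally show ?thesis
    by (simp add: joint_force_q)
qed

text \<open>A joint off the blocks meets free edges only, and at a joint of a block all other bars belong
  to that block, by separation.  So the equilibrium equations say that the free edges balance the
  joints off the blocks, and that each block resolves the load that they put on it.\<close>

lemma stresses_iff:
  "l \<in> stresses (G_S P K) q \<longleftrightarrow>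
    (\<forall>e. e \<notin> edges (G_S P K) \<longrightarrow> l e = 0) \<and>
    (\<forall>v. off_blocks v \<longrightarrow> joint_force P p (restrict_free l) v = 0) \<and>
    (\<forall>B\<in>blocks P. resolves (K B) q (joint_force P p (restrict_free l)) l)"
proof -
  have "resolves (G_S P K) q (\<lambda>_. 0) l \<longleftrightarrow>
      (\<forall>v. off_blocks v \<longrightarrow> joint_force (G_S P K) q l v = 0) \<and>
      (\<forall>B\<in>blocks P. \<forall>v\<in>verts (K B). joint_force (G_S P K) q l v = 0)"
    unfolding resolves_iff_joint_force verts_G_S by auto
  then show ?thesis
    by (simp add: stresses_def resolves_iff_joint_force joint_force_off_blocks
        joint_force_on_block)
qed

lemma sum_joint_force_block:
  assumes B: "B \<in> blocks P"
  shows "(\<Sum>v\<in>verts (K B). joint_force P p w v) = (\<Sum>v\<in>face_verts B. joint_force P p w v)"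
proof (rule sum.mono_neutral_right)
  show "finite (verts (K B))"
    using block_simple[OF B] by (simp add: simple_graph_def)
  show "face_verts B \<subseteq> verts (K B)"
    using block_verts[OF B] by blast
  show "\<forall>v\<in>verts (K B) - face_verts B. joint_force P p w v = 0"
    using block_verts[OF B] joint_force_outside by blast
qed

text \<open>The load resolved by a block has total zero, since the bars of the block exert none; this is
  the cycle condition around the block.\<close>

lemma restrict_free_stress:
  assumes l: "l \<in> stresses (G_S P K) q"
  shows "restrict_free l \<in> motion_assignments (swapped P) p"
  unfolding motion_assignments_swapped_iff
proof (intro conjI ballI)
  fix B
  assume B: "B \<in> blocks P"
  interpret K: simple_graph_darts "K B"
    by unfold_locales (rule block_simple[OF B])
  have "\<forall>v\<in>verts (K B). joint_force P p (restrict_free l) v = - joint_force (K B) q l v"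
    using l B by (simp add: stresses_iff resolves_iff_joint_force eq_neg_iff_add_eq_0)
  then have "(\<Sum>v\<in>verts (K B). joint_force P p (restrict_free l) v) = 0"
    by (simp add: sum_negf K.sum_joint_force)
  then show "(\<Sum>v\<in>face_verts B. joint_force P p (restrict_free l) v) = 0"
    by (simp add: sum_joint_force_block[OF B])
qed (use l in \<open>auto simp: stresses_iff restrict_free_def\<close>)

lemma resolves_cong:
  assumes "\<And>e. e \<in> edges G \<Longrightarrow> l e = l' e"
  shows "resolves G r L l \<longleftrightarrow> resolves G r L l'"
  using assms by (simp add: resolves_def nbrs_def)

text \<open>Two stresses that agree on the free edges differ on each block by a self-stress of that block,
  and the block is independent.\<close>

lemma inj_on_restrict_free: "inj_on restrict_free (stresses (G_S P K) q)"
proof (rule inj_onI)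
  fix l l'
  assume l: "l \<in> stresses (G_S P K) q" and l': "l' \<in> stresses (G_S P K) q"
    and eq: "restrict_free l = restrict_free l'"
  have "l e = l' e" if B: "B \<in> blocks P" and "e \<in> edges (K B)" for B e
  proof -
    let ?d = "\<lambda>e. l e - l' e"
    let ?m = "\<lambda>e. if e \<in> edges (K B) then ?d e else 0"
    have "resolves (K B) q (\<lambda>_. 0) ?d"
      using l l' B eq by (simp add: stresses_iff resolves_iff_joint_force joint_force_diff)
        (metis add_left_cancel)
    then have "resolves (K B) q (\<lambda>_. 0) ?m"
      using resolves_cong[of "K B" ?d ?m] by simp
    then have "?m \<in> stresses (K B) q"
      by (simp add: stresses_def)
    then have "?m = (\<lambda>_. 0)"
      using block_isostatic[OF B] by (simp add: isostatic_def independent_framework_def)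
    then have "?m e = 0"
      by (rule fun_cong)
    then show ?thesis
      using that(2) by simp
  qed
  moreover have "l e = l' e" if "e \<in> free_edges" for e
    using fun_cong[OF eq, of e] that by (simp add: restrict_free_def)
  moreover have "l e = l' e" if "e \<notin> edges (G_S P K)" for e
    using that l l' by (simp add: stresses_iff)
  ultimately show "l = l'"
    unfolding edges_G_S by blast
qed

text \<open>The cycle condition around a block says that its load is in equilibrium, and the block is
  statically rigid.\<close>

lemma motion_extends_to_stress:
  assumes w: "w \<in> motion_assignments (swapped P) p"
  shows "\<exists>l\<in>stresses (G_S P K) q. restrict_free l = w"
proof -
  let ?L = "joint_force P p w"
  have supp: "w e = 0" if "e \<notin> free_edges" for e
    using w that by (simp add: motion_assignments_swapped_iff)
  have "\<exists>m. resolves (K B) q ?L m" if B: "B \<in> blocks P" for B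
  proof -
    have "load_at (q v) (?L v)" for v
      using load_at_joint_force[of q v P w] by (simp add: joint_force_q)
    moreover have "(\<Sum>v\<in>verts (K B). ?L v) = 0"
      using w B by (simp add: sum_joint_force_block motion_assignments_swapped_iff)
    ultimately have "equilibrium_load (K B) q ?L"
      by (simp add: equilibrium_load_def)
    then show ?thesis
      using block_isostatic[OF B] by (simp add: isostatic_def statically_rigid_def)
  qed
  then obtain m where m: "\<And>B. B \<in> blocks P \<Longrightarrow> resolves (K B) q ?L (m B)"
    by metis
  \<comment> \<open>An edge lies in at most one block, so the sum has at most one term, and none on a free edge.\<close>
  define l where "l e = w e + (\<Sum>B | B \<in> blocks P \<and> e \<in> edges (K B). m B e)" for e
  have l_block: "l e = m B e" if "B \<in> blocks P" "e \<in> edges (K B)" for B e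
  proof -
    have "{C. C \<in> blocks P \<and> e \<in> edges (K C)} = {B}"
      using that block_edge_unique by blast
    then show ?thesis
      using supp[of e] free_edge_not_block that by (auto simp: l_def)
  qed
  have l_other: "l e = w e" if "\<And>B. B \<in> blocks P \<Longrightarrow> e \<notin> edges (K B)" for e
  proof -
    have "{B. B \<in> blocks P \<and> e \<in> edges (K B)} = {}"
      using that by blast
    then show ?thesis
      by (simp only: l_def) simp
  qed
  have restr: "restrict_free l = w"
    using l_other free_edge_not_block supp by (auto simp: restrict_free_def fun_eq_iff)
  have "l e = 0" if "e \<notin> edges (G_S P K)" for e
    using that l_other[of e] supp[of e] by (simp add: edges_G_S)
  moreover have "resolves (K B) q ?L l" if "B \<in> blocks P" for B
    using m[OF that] l_block[OF that] resolves_cong[of "K B" l "m B"] by blast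
  ultimately have "l \<in> stresses (G_S P K) q"
    using w by (simp add: stresses_iff restr motion_assignments_swapped_iff)
  then show ?thesis
    using restr by blast
qed

end

theorem theorem3p3:
  fixes P :: "'v bh_poly" and p q :: "'v \<Rightarrow> real^4" and K :: "('v \<times> 'v) set \<Rightarrow> 'v ugraph"
  assumes "block_hole_polyhedron P"
    and "separated P"
    and "\<forall>v \<in> verts P. point_rep (p v)"
    and "bh_general_position P p"
    and "block_filling P p K q"
  shows "stresses (G_S P K) q \<simeq>\<^sub>l motion_assignments (swapped P) p"
proof -
  interpret filled_polyhedron P K p q
    using assms(1,2,5) by unfold_locales
  have "bij_betw restrict_free (stresses (G_S P K) q) (motion_assignments (swapped P) p)"
  proof (rule bij_betw_imageI[OF inj_on_restrict_free])
    show "restrict_free ` stresses (G_S P K) q = motion_assignments (swapped P) p"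
      using restrict_free_stress motion_extends_to_stress by blast
  qed
  then show ?thesis
    unfolding linearly_isomorphic_def
    by (intro exI[where x = restrict_free]) (auto simp: restrict_free_def fun_eq_iff)
qed

end
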